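(* Let $M=(M,d_M)$, $N=(N,d_N)$ be chain complexes and let $F:M\to N$, $G:N\to M$ be degree $0$ chain maps and $H:M\to M$, $L:N\to N$ degree $1$ maps with $GF-1_M=d_MH+Hd_M$ and $FG-1_N=d_NL+Ld_N$. Consider the cycles $\mathfrak o_M:=FH-LF\in\mathrm{Hom}_1(M,N)$ and $\mathfrak o_N:=GL-HG\in\mathrm{Hom}_1(N,M)$. Then $[\mathfrak o_M]\in H_1(\mathrm{Hom}(M,N))$ vanishes if and only if $[\mathfrak o_N]\in H_1(\mathrm{Hom}(N,M))$ vanishes. Moreover, the restricted action $$f_0\mapsto F,\quad g_0\mapsto G,\quad f_1\mapsto H,\quad g_1\mapsto L$$ can be extended to a full action $A:\mathcal R_{\rm iso}\to\mathrm{End}_{M,N}$ (i.e. there is a morphism of differential graded colored operads $A$ with these values on $f_0,g_0,f_1,g_1$) if and only if one (and hence both) of the classes $[\mathfrak o_M]$, $[\mathfrak o_N]$ vanishes.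
   Context: Chain complexes are $\mathbb Z$-graded complexes of abelian groups with differential of degree $-1$. $\mathrm{Hom}(M,N)$ is the complex whose degree $n$ part is the group of degree $n$ linear maps, with differential $\phi\mapsto d_N\phi-(-1)^{\deg\phi}\phi d_M$. A $\{B,W\}$-colored operad here (only unary operations) is a category with two objects $B,W$ enriched over chain complexes; morphisms are enriched functors that are the identity on $\{B,W\}$. The free one $\mathcal F(S)$ on a set $S$ of graded arrows has hom-groups freely spanned by composable words in $S$ (including empty words $1_B,1_W$); $uv$ means $u\circ v$; differentials satisfy $d(uv)=d(u)v+(-1)^{\deg u}u\,d(v)$. $\mathrm{End}_{M,N}$ is the full subcategory of chain complexes (with Hom complexes as hom-objects) on $M$ and $N$; an action $A:\mathcal P\to\mathrm{End}_{M,N}$ sends $B\mapsto M$, $W\mapsto N$. $\mathcal R_{\rm iso}:=(\mathcal F(f_0,f_1,\ldots;g_0,g_1,\ldots),d)$ with $\deg f_n=\deg g_n=n$; $f_n:B\to W$ for $n$ even, $f_n:B\to B$ for $n$ odd; $g_n:W\to B$ for $n$ even, $g_n:W\to W$ for $n$ odd; and $df_0=dg_0=0$, $df_1=g_0f_0-1_B$, $dg_1=f_0g_0-1_W$, and for $m\ge1$ $$df_{2m}=\sum_{0\le i<m}(f_{2i}f_{2(m-i)-1}-g_{2(m-i)-1}f_{2i}),\quad df_{2m+1}=\sum_{0\le j\le m}g_{2j}f_{2(m-j)}-\sum_{0\le j<m}f_{2j+1}f_{2(m-j)-1},$$ $$dg_{2m}=\sum_{0\le i<m}(g_{2i}g_{2(m-i)-1}-f_{2(m-i)-1}g_{2i}),\quad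 dg_{2m+1}=\sum_{0\le j\le m}f_{2j}g_{2(m-j)}-\sum_{0\le j<m}g_{2j+1}g_{2(m-j)-1}.$$ *)

theory Defs
  imports "HOL-Algebra.Free_Abelian_Groups"
begin

text \<open>
  Abelian groups are the multiplicatively written \<^term>\<open>comm_group\<close>s of HOL-Algebra. Hence a sum
  \<open>x + y\<close> of the mathematics appears as \<open>x \<otimes> y\<close>, a difference \<open>x - y\<close> as \<open>x \<otimes> inv y\<close>, zero as
  \<open>\<one>\<close>, and an integer multiple \<open>k x\<close> as \<open>x [^] k\<close>.
\<close>

section \<open>Chain complexes\<close>

record 'a pre_complex =
  grp :: "int \<Rightarrow> 'a monoid"
  bd :: "int \<Rightarrow> 'a \<Rightarrow> 'a"

locale chain_complex =
  fixes C :: "'a pre_complex"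
  assumes comm_group_grp: "comm_group (grp C n)"
    and bd_hom: "bd C n \<in> hom (grp C n) (grp C (n - 1))"
    and bd_bd: "x \<in> carrier (grp C n) \<Longrightarrow> bd C (n - 1) (bd C n x) = \<one>\<^bsub>grp C (n - 2)\<^esub>"

definition cycles :: "'a pre_complex \<Rightarrow> int \<Rightarrow> 'a set" where
  "cycles C n = kernel (grp C n) (grp C (n - 1)) (bd C n)"

definition boundaries :: "'a pre_complex \<Rightarrow> int \<Rightarrow> 'a set" where
  "boundaries C n = bd C (n + 1) ` carrier (grp C (n + 1))"

definition homology :: "'a pre_complex \<Rightarrow> int \<Rightarrow> 'a set monoid" where
  "homology C n = (grp C n)\<lparr>carrier := cycles C n\<rparr> Mod boundaries C n"

definition homology_class :: "'a pre_complex \<Rightarrow> int \<Rightarrow> 'a \<Rightarrow> 'a set" where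
  "homology_class C n z = boundaries C n #>\<^bsub>grp C n\<^esub> z"

text \<open>The sign \<open>(-1)\<^sup>n\<close> for an integer \<open>n\<close>.\<close>

definition ksign :: "int \<Rightarrow> int" where
  "ksign n = (if even n then 1 else -1)"


section \<open>The Hom complex\<close>

text \<open>
  A degree \<open>n\<close> map \<open>\<phi> : M \<rightarrow> N\<close> is a family of homomorphisms \<open>\<phi> k : M\<^sub>k \<rightarrow> N\<^sub>k\<^sub>+\<^sub>n\<close>. Each component is
  \<^term>\<open>extensional\<close>, so that equality of families is equality of graded maps.
\<close>

type_synonym ('a, 'b) graded_map = "int \<Rightarrow> 'a \<Rightarrow> 'b"

definition graded_maps ::
    "'a pre_complex \<Rightarrow> 'b pre_complex \<Rightarrow> int \<Rightarrow> ('a, 'b) graded_map set" where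
  "graded_maps M N n =
     {\<phi>. \<forall>k. \<phi> k \<in> hom (grp M k) (grp N (k + n)) \<and> \<phi> k \<in> extensional (carrier (grp M k))}"

definition Hom_grp ::
    "'a pre_complex \<Rightarrow> 'b pre_complex \<Rightarrow> int \<Rightarrow> ('a, 'b) graded_map monoid" where
  "Hom_grp M N n =
     \<lparr>carrier = graded_maps M N n,
      monoid.mult = (\<lambda>\<phi> \<psi> k. \<lambda>x\<in>carrier (grp M k). \<phi> k x \<otimes>\<^bsub>grp N (k + n)\<^esub> \<psi> k x),
      one = (\<lambda>k. \<lambda>x\<in>carrier (grp M k). \<one>\<^bsub>grp N (k + n)\<^esub>)\<rparr>"

text \<open>\<open>d \<phi> = d\<^sub>N \<phi> - (-1)\<^sup>n \<phi> d\<^sub>M\<close> for \<open>\<phi>\<close> of degree \<open>n\<close>.\<close>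

definition Hom_bd ::
    "'a pre_complex \<Rightarrow> 'b pre_complex \<Rightarrow> int \<Rightarrow> ('a, 'b) graded_map \<Rightarrow> ('a, 'b) graded_map" where
  "Hom_bd M N n \<phi> =
     (\<lambda>k. \<lambda>x\<in>carrier (grp M k).
        bd N (k + n) (\<phi> k x)
          \<otimes>\<^bsub>grp N (k + n - 1)\<^esub>
        inv\<^bsub>grp N (k + n - 1)\<^esub> (\<phi> (k - 1) (bd M k x) [^]\<^bsub>grp N (k + n - 1)\<^esub> ksign n))"

definition Hom_complex ::
    "'a pre_complex \<Rightarrow> 'b pre_complex \<Rightarrow> ('a, 'b) graded_map pre_complex" where
  "Hom_complex M N = \<lparr>grp = Hom_grp M N, bd = Hom_bd M N\<rparr>"

text \<open>The composite \<open>\<psi> \<phi>\<close>, where \<open>\<phi>\<close> is a map out of \<open>M\<close> of degree \<open>q\<close>.\<close>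

definition graded_comp ::
    "'a pre_complex \<Rightarrow> int \<Rightarrow> ('b, 'c) graded_map \<Rightarrow> ('a, 'b) graded_map \<Rightarrow> ('a, 'c) graded_map" where
  "graded_comp M q \<psi> \<phi> = (\<lambda>k. \<lambda>x\<in>carrier (grp M k). \<psi> (k + q) (\<phi> k x))"

definition graded_id :: "'a pre_complex \<Rightarrow> ('a, 'a) graded_map" where
  "graded_id M = (\<lambda>k. \<lambda>x\<in>carrier (grp M k). x)"

definition chain_map ::
    "'a pre_complex \<Rightarrow> 'b pre_complex \<Rightarrow> ('a, 'b) graded_map \<Rightarrow> bool" where
  "chain_map M N \<phi> \<longleftrightarrow>
     \<phi> \<in> graded_maps M N 0 \<and>
     (\<forall>k. \<forall>x\<in>carrier (grp M k). bd N k (\<phi> k x) = \<phi> (k - 1) (bd M k x))"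

text \<open>\<open>H\<close> is a degree 1 map with \<open>\<phi> - \<psi> = d\<^sub>N H + H d\<^sub>M\<close>.\<close>

definition chain_homotopy ::
    "'a pre_complex \<Rightarrow> 'b pre_complex \<Rightarrow> ('a, 'b) graded_map \<Rightarrow> ('a, 'b) graded_map
       \<Rightarrow> ('a, 'b) graded_map \<Rightarrow> bool" where
  "chain_homotopy M N \<phi> \<psi> H \<longleftrightarrow>
     H \<in> graded_maps M N 1 \<and>
     (\<forall>k. \<forall>x\<in>carrier (grp M k).
        \<phi> k x \<otimes>\<^bsub>grp N k\<^esub> inv\<^bsub>grp N k\<^esub> (\<psi> k x) =
        bd N (k + 1) (H k x) \<otimes>\<^bsub>grp N k\<^esub> H (k - 1) (bd M k x))"

text \<open>
  The element \<open>F H - L F\<close> of \<open>Hom\<^sub>1(M,N)\<close>, for \<open>F : M \<rightarrow> N\<close> of degree 0 and \<open>H : M \<rightarrow> M\<close>,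
  \<open>L : N \<rightarrow> N\<close> of degree 1.
\<close>

definition obstruction ::
    "'a pre_complex \<Rightarrow> 'b pre_complex \<Rightarrow> ('a, 'b) graded_map \<Rightarrow> ('a, 'a) graded_map
       \<Rightarrow> ('b, 'b) graded_map \<Rightarrow> ('a, 'b) graded_map" where
  "obstruction M N F H L =
     graded_comp M 1 F H \<otimes>\<^bsub>Hom_grp M N 1\<^esub> inv\<^bsub>Hom_grp M N 1\<^esub> (graded_comp M 0 L F)"


section \<open>Colored operads with unary operations\<close>

datatype color = B | W

text \<open>
  \<open>arr P X Y\<close> is the complex of operations from \<open>X\<close> to \<open>Y\<close>, and \<open>cmp P X Y Z p q u v\<close> is the
  composite \<open>u v\<close> of \<open>u\<close> in \<open>arr P Y Z\<close> of degree \<open>p\<close> after \<open>v\<close> in \<open>arr P X Y\<close> of degree \<open>q\<close>.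
\<close>

record 'm pre_operad =
  arr :: "color \<Rightarrow> color \<Rightarrow> 'm pre_complex"
  cmp :: "color \<Rightarrow> color \<Rightarrow> color \<Rightarrow> int \<Rightarrow> int \<Rightarrow> 'm \<Rightarrow> 'm \<Rightarrow> 'm"
  ident :: "color \<Rightarrow> 'm"

abbreviation ops :: "'m pre_operad \<Rightarrow> color \<Rightarrow> color \<Rightarrow> int \<Rightarrow> 'm monoid" where
  "ops P X Y n \<equiv> grp (arr P X Y) n"

locale colored_operad =
  fixes P :: "'m pre_operad"
  assumes chain_complex_arr: "chain_complex (arr P X Y)"
    and cmp_closed:
      "\<lbrakk>u \<in> carrier (ops P Y Z p); v \<in> carrier (ops P X Y q)\<rbrakk>
        \<Longrightarrow> cmp P X Y Z p q u v \<in> carrier (ops P X Z (p + q))"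
    and cmp_left_add:
      "\<lbrakk>u \<in> carrier (ops P Y Z p); u' \<in> carrier (ops P Y Z p); v \<in> carrier (ops P X Y q)\<rbrakk>
        \<Longrightarrow> cmp P X Y Z p q (u \<otimes>\<^bsub>ops P Y Z p\<^esub> u') v =
            cmp P X Y Z p q u v \<otimes>\<^bsub>ops P X Z (p + q)\<^esub> cmp P X Y Z p q u' v"
    and cmp_right_add:
      "\<lbrakk>u \<in> carrier (ops P Y Z p); v \<in> carrier (ops P X Y q); v' \<in> carrier (ops P X Y q)\<rbrakk>
        \<Longrightarrow> cmp P X Y Z p q u (v \<otimes>\<^bsub>ops P X Y q\<^esub> v') =
            cmp P X Y Z p q u v \<otimes>\<^bsub>ops P X Z (p + q)\<^esub> cmp P X Y Z p q u v'"
    and bd_cmp: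
      "\<lbrakk>u \<in> carrier (ops P Y Z p); v \<in> carrier (ops P X Y q)\<rbrakk>
        \<Longrightarrow> bd (arr P X Z) (p + q) (cmp P X Y Z p q u v) =
            cmp P X Y Z (p - 1) q (bd (arr P Y Z) p u) v
              \<otimes>\<^bsub>ops P X Z (p + q - 1)\<^esub>
            (cmp P X Y Z p (q - 1) u (bd (arr P X Y) q v) [^]\<^bsub>ops P X Z (p + q - 1)\<^esub> ksign p)"
    and cmp_assoc:
      "\<lbrakk>u \<in> carrier (ops P Y Z p); v \<in> carrier (ops P X Y q); w \<in> carrier (ops P V X r)\<rbrakk>
        \<Longrightarrow> cmp P V X Z (p + q) r (cmp P X Y Z p q u v) w =
            cmp P V Y Z p (q + r) u (cmp P V X Y q r v w)"
    and ident_closed: "ident P X \<in> carrier (ops P X X 0)"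
    and bd_ident: "bd (arr P X X) 0 (ident P X) = \<one>\<^bsub>ops P X X (-1)\<^esub>"
    and cmp_ident_left:
      "u \<in> carrier (ops P X Y p) \<Longrightarrow> cmp P X Y Y 0 p (ident P Y) u = u"
    and cmp_ident_right:
      "u \<in> carrier (ops P X Y p) \<Longrightarrow> cmp P X X Y p 0 u (ident P X) = u"

locale operad_morphism = dom: colored_operad P + cod: colored_operad Q
  for P :: "'m pre_operad" and Q :: "'k pre_operad" +
  fixes A :: "color \<Rightarrow> color \<Rightarrow> int \<Rightarrow> 'm \<Rightarrow> 'k"
  assumes map_hom: "A X Y n \<in> hom (ops P X Y n) (ops Q X Y n)"
    and map_bd:
      "u \<in> carrier (ops P X Y n)
        \<Longrightarrow> A X Y (n - 1) (bd (arr P X Y) n u) = bd (arr Q X Y) n (A X Y n u)"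
    and map_cmp:
      "\<lbrakk>u \<in> carrier (ops P Y Z p); v \<in> carrier (ops P X Y q)\<rbrakk>
        \<Longrightarrow> A X Z (p + q) (cmp P X Y Z p q u v) = cmp Q X Y Z p q (A Y Z p u) (A X Y q v)"
    and map_ident: "A X X 0 (ident P X) = ident Q X"


section \<open>The operad \<open>End\<^sub>M\<^sub>,\<^sub>N\<close>\<close>

definition End_operad ::
    "'a pre_complex \<Rightarrow> 'a pre_complex \<Rightarrow> ('a, 'a) graded_map pre_operad" where
  "End_operad M N =
     (let ob = (\<lambda>X. case X of B \<Rightarrow> M | W \<Rightarrow> N) in
       \<lparr>arr = (\<lambda>X Y. Hom_complex (ob X) (ob Y)),
        cmp = (\<lambda>X Y Z p q u v. graded_comp (ob X) q u v),
        ident = (\<lambda>X. graded_id (ob X))\<rparr>)"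


section \<open>Free operads\<close>

text \<open>
  A graded set of arrows is a type \<open>'s\<close> with source, target and degree functions \<open>s\<close>, \<open>t\<close>, \<open>deg\<close>.
  The list \<open>[a\<^sub>1, \<dots>, a\<^sub>k]\<close> stands for the word \<open>a\<^sub>1 \<circ> \<dots> \<circ> a\<^sub>k\<close>, so its last letter is applied first.
  The empty list is the empty word \<open>1\<^sub>X\<close>, for either color \<open>X\<close>.
\<close>

fun is_word :: "('s \<Rightarrow> color) \<Rightarrow> ('s \<Rightarrow> color) \<Rightarrow> color \<Rightarrow> color \<Rightarrow> 's list \<Rightarrow> bool" where
  "is_word s t X Y [] \<longleftrightarrow> X = Y"
| "is_word s t X Y (a # w) \<longleftrightarrow> t a = Y \<and> is_word s t X (s a) w"

definition word_deg :: "('s \<Rightarrow> int) \<Rightarrow> 's list \<Rightarrow> int" where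
  "word_deg deg w = (\<Sum>a\<leftarrow>w. deg a)"

definition words ::
    "('s \<Rightarrow> color) \<Rightarrow> ('s \<Rightarrow> color) \<Rightarrow> ('s \<Rightarrow> int) \<Rightarrow> color \<Rightarrow> color \<Rightarrow> int \<Rightarrow> 's list set" where
  "words s t deg X Y n = {w. is_word s t X Y w \<and> word_deg deg w = n}"

text \<open>The bilinear extension of concatenation.\<close>

definition concat_prod :: "('s list \<Rightarrow>\<^sub>0 int) \<Rightarrow> ('s list \<Rightarrow>\<^sub>0 int) \<Rightarrow> ('s list \<Rightarrow>\<^sub>0 int)" where
  "concat_prod x y = frag_extend (\<lambda>u. frag_extend (\<lambda>v. frag_of (u @ v)) y) x"

text \<open>
  The values \<open>\<delta>\<close> on the arrows are extended to words by \<open>d(a w) = d(a) w + (-1)\<^sup>d\<^sup>e\<^sup>g \<^sup>a a d(w)\<close>, and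
  then linearly.
\<close>

fun word_bd :: "('s \<Rightarrow> int) \<Rightarrow> ('s \<Rightarrow> 's list \<Rightarrow>\<^sub>0 int) \<Rightarrow> 's list \<Rightarrow> 's list \<Rightarrow>\<^sub>0 int" where
  "word_bd deg \<delta> [] = 0"
| "word_bd deg \<delta> (a # w) =
     concat_prod (\<delta> a) (frag_of w)
       + frag_cmul (ksign (deg a)) (concat_prod (frag_of [a]) (word_bd deg \<delta> w))"

definition free_operad ::
    "('s \<Rightarrow> color) \<Rightarrow> ('s \<Rightarrow> color) \<Rightarrow> ('s \<Rightarrow> int) \<Rightarrow> ('s \<Rightarrow> 's list \<Rightarrow>\<^sub>0 int)
       \<Rightarrow> ('s list \<Rightarrow>\<^sub>0 int) pre_operad" where
  "free_operad s t deg \<delta> =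
     \<lparr>arr = (\<lambda>X Y. \<lparr>grp = (\<lambda>n. free_Abelian_group (words s t deg X Y n)),
                    bd = (\<lambda>n. frag_extend (word_bd deg \<delta>))\<rparr>),
      cmp = (\<lambda>X Y Z p q. concat_prod),
      ident = (\<lambda>X. frag_of [])\<rparr>"


section \<open>The operad \<open>R\<^sub>i\<^sub>s\<^sub>o\<close>\<close>

datatype iso_gen = Fg nat | Gg nat

fun iso_src :: "iso_gen \<Rightarrow> color" where
  "iso_src (Fg n) = B"
| "iso_src (Gg n) = W"

fun iso_tgt :: "iso_gen \<Rightarrow> color" where
  "iso_tgt (Fg n) = (if even n then W else B)"
| "iso_tgt (Gg n) = (if even n then B else W)"

fun iso_deg :: "iso_gen \<Rightarrow> int" where
  "iso_deg (Fg n) = int n"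
| "iso_deg (Gg n) = int n"

text \<open>
  The formulas for \<open>d f\<^sub>n\<close> and \<open>d g\<^sub>n\<close> are interchanged by swapping the letters \<open>f\<close> and \<open>g\<close>.
  Below \<open>x\<close> is the letter being differentiated and \<open>y\<close> is the other one.
\<close>

definition iso_bd_gen ::
    "(nat \<Rightarrow> iso_gen) \<Rightarrow> (nat \<Rightarrow> iso_gen) \<Rightarrow> nat \<Rightarrow> iso_gen list \<Rightarrow>\<^sub>0 int" where
  "iso_bd_gen x y n =
     (if n = 0 then 0
      else if n = 1 then frag_of [y 0, x 0] - frag_of []
      else if even n then
        (let m = n div 2 in
          \<Sum>i<m. frag_of [x (2 * i), x (2 * (m - i) - 1)] - frag_of [y (2 * (m - i) - 1), x (2 * i)])
      else
        (let m = n div 2 in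
          (\<Sum>j\<le>m. frag_of [y (2 * j), x (2 * (m - j))])
            - (\<Sum>j<m. frag_of [x (2 * j + 1), x (2 * (m - j) - 1)])))"

fun iso_bd :: "iso_gen \<Rightarrow> iso_gen list \<Rightarrow>\<^sub>0 int" where
  "iso_bd (Fg n) = iso_bd_gen Fg Gg n"
| "iso_bd (Gg n) = iso_bd_gen Gg Fg n"

definition R_iso :: "(iso_gen list \<Rightarrow>\<^sub>0 int) pre_operad" where
  "R_iso = free_operad iso_src iso_tgt iso_deg iso_bd"

end

theory Submission
  imports Defs "HOL-Computational_Algebra.Formal_Power_Series"
begin

text \<open>
  A contraction of the mapping cone of \<open>F\<close> has four components: \<open>G\<close>, \<open>H\<close>, \<open>L\<close> and a map \<open>P\<close> of
  degree 2 with \<open>d P = F H - L F\<close>. So once \<open>[F H - L F]\<close> vanishes, all remaining values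
  \<open>g\<^sub>n\<close>, \<open>f\<^sub>n\<^sub>+\<^sub>1\<close> (\<open>n \<ge> 2\<close>) of the action can be produced recursively: the two relations that they have to
  satisfy say that they bound a given cycle of the cone, to which the contraction is applied. The
  recursion is carried out once and for all in the free operad on \<open>F\<close>, \<open>G\<close>, \<open>H\<close>, \<open>L\<close>, \<open>P\<close>, whose
  elements form a ring. There, with \<open>x = \<Sum> f\<^sub>2\<^sub>i u\<^sup>i\<close>, \<open>\<phi> = \<Sum> f\<^sub>2\<^sub>i\<^sub>+\<^sub>1 u\<^sup>i\<close>, \<open>y = \<Sum> g\<^sub>2\<^sub>i u\<^sup>i\<close> and
  \<open>\<gamma> = \<Sum> g\<^sub>2\<^sub>i\<^sub>+\<^sub>1 u\<^sup>i\<close>, the relations read \<open>d x = u (x \<phi> - \<gamma> x)\<close>, \<open>d \<phi> = y x - 1 - u \<phi> \<phi>\<close> and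
  symmetrically in \<open>(x, \<phi>)\<close> and \<open>(y, \<gamma>)\<close>.

  Conversely, an action provides \<open>f\<^sub>2\<close> and \<open>g\<^sub>2\<close>, whose images bound \<open>F H - L F\<close> and \<open>G L - H G\<close>. Hence
  the vanishing of one class yields an action and thereby the vanishing of the other.
\<close>

section \<open>Free operads as graded rings\<close>

text \<open>With concatenation as addition of exponents, the convolution product makes
  \<open>'s list \<Rightarrow>\<^sub>0 int\<close> the integral monoid ring of the free monoid.
  Composition in a free operad becomes multiplication in a single noncommutative ring.\<close>

instantiation list :: (type) monoid_add
begin
definition zero_list :: "'a list" where "zero_list = []"
definition plus_list :: "'a list \<Rightarrow> 'a list \<Rightarrow> 'a list" where "plus_list u v = u @ v"
instance by standard (simp_all add: zero_list_def plus_list_def)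
end

lemma frag_of_Nil: "frag_of [] = 1"
  by (simp add: zero_list_def flip: single_one)

lemma frag_of_append: "frag_of (u @ v) = frag_of u * frag_of v"
  by (simp add: mult_single plus_list_def)

lemma frag_of_Cons: "frag_of (a # w) = frag_of [a] * frag_of w"
  using frag_of_append[of "[a]" w] by simp

text \<open>Words generate the group under differences, which is how \<open>frag_induction\<close>
  proceeds. Additivity is therefore asked for as compatibility with subtraction.\<close>

lemma frag_linear_eqI:
  assumes "\<And>x y. f (x - y) = f x - f y" "\<And>x y. g (x - y) = g x - g y"
    and "\<And>w. f (frag_of w) = (g (frag_of w) :: 'b::group_add)"
  shows "f x = g x"
proof -
  have "Poly_Mapping.keys x \<subseteq> UNIV" by simp
  then show ?thesis
  proof (induction x rule: frag_induction)
    case zero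
    show ?case using assms(1)[of 0 0] assms(2)[of 0 0] by simp
  qed (use assms in simp_all)
qed

lemma frag_extend_append: "frag_extend (\<lambda>v. frag_of (u @ v)) y = frag_of u * y"
  by (rule frag_linear_eqI) (simp_all add: frag_extend_diff frag_of_append algebra_simps)

lemma concat_prod_eq_times: "concat_prod x y = x * y"
  unfolding concat_prod_def frag_extend_append
  by (rule frag_linear_eqI) (simp_all add: frag_extend_diff algebra_simps)

lemma ksign_0 [simp]: "ksign 0 = 1" and ksign_1 [simp]: "ksign 1 = -1"
  by (simp_all add: ksign_def)

lemma word_deg_simps [simp]:
  "word_deg deg [] = 0" "word_deg deg (a # w) = deg a + word_deg deg w"
  "word_deg deg (u @ v) = word_deg deg u + word_deg deg v"
  by (simp_all add: word_deg_def)

lemma is_word_append: "is_word s t Y Z u \<Longrightarrow> is_word s t X Y v \<Longrightarrow> is_word s t X Z (u @ v)"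
  by (induction u arbitrary: Z) auto

lemma frag_cmul_ksign: "frag_cmul (ksign n) x = (if even n then x else - x)"
  by (simp add: ksign_def)

definition free_bd :: "('s \<Rightarrow> int) \<Rightarrow> ('s \<Rightarrow> 's list \<Rightarrow>\<^sub>0 int) \<Rightarrow> ('s list \<Rightarrow>\<^sub>0 int) \<Rightarrow> 's list \<Rightarrow>\<^sub>0 int" where
  "free_bd deg \<delta> = frag_extend (word_bd deg \<delta>)"

text \<open>The grading automorphism, with sign (-1)^n on words of degree n. It takes the place of
  the sign in the Leibniz rule, which then holds for inhomogeneous elements too.\<close>

definition parity :: "('s \<Rightarrow> int) \<Rightarrow> ('s list \<Rightarrow>\<^sub>0 int) \<Rightarrow> 's list \<Rightarrow>\<^sub>0 int" where
  "parity deg = frag_extend (\<lambda>w. frag_cmul (ksign (word_deg deg w)) (frag_of w))"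

lemma parity_diff: "parity deg (x - y) = parity deg x - parity deg y"
  by (simp add: parity_def frag_extend_diff)

lemma free_bd_diff: "free_bd deg \<delta> (x - y) = free_bd deg \<delta> x - free_bd deg \<delta> y"
  by (simp add: free_bd_def frag_extend_diff)

lemma parity_mult: "parity deg (x * y) = parity deg x * parity deg y"
proof -
  have left: "parity deg (frag_of u * y) = parity deg (frag_of u) * parity deg y" for u
    by (rule frag_linear_eqI[of "\<lambda>y. parity deg (frag_of u * y)"])
      (simp_all add: parity_diff right_diff_distrib, simp add: parity_def frag_cmul_ksign flip: frag_of_append)
  show ?thesis
    by (rule frag_linear_eqI[of "\<lambda>x. parity deg (x * y)"])
      (simp_all add: parity_diff left_diff_distrib left)
qed

lemma free_bd_frag_of_Cons:
  "free_bd deg \<delta> (frag_of (a # w)) =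
     \<delta> a * frag_of w + parity deg (frag_of [a]) * free_bd deg \<delta> (frag_of w)"
  by (simp add: free_bd_def parity_def concat_prod_eq_times frag_cmul_ksign)

text \<open>\<open>word_bd\<close> is defined by the Leibniz rule for splitting off one letter.
  Induction on the first word extends this to every splitting of a word, because
  \<open>parity\<close> is multiplicative. Bilinearity does the rest.\<close>

lemma free_bd_mult:
  "free_bd deg \<delta> (x * y) = free_bd deg \<delta> x * y + parity deg x * free_bd deg \<delta> y"
proof -
  have word: "free_bd deg \<delta> (frag_of u * frag_of v) =
      free_bd deg \<delta> (frag_of u) * frag_of v + parity deg (frag_of u) * free_bd deg \<delta> (frag_of v)" for u v
  proof (induction u)
    case Nil
    then show ?case
      by (simp add: free_bd_def parity_def frag_of_Nil[symmetric])
        (simp add: frag_of_Nil)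
  next
    case (Cons a u)
    have "free_bd deg \<delta> (frag_of (a # u) * frag_of v) = free_bd deg \<delta> (frag_of (a # (u @ v)))"
      by (simp flip: frag_of_append)
    also have "\<dots> = \<delta> a * frag_of (u @ v) + parity deg (frag_of [a]) * free_bd deg \<delta> (frag_of u * frag_of v)"
      by (simp add: free_bd_frag_of_Cons frag_of_append)
    also have "parity deg (frag_of (a # u)) = parity deg (frag_of [a]) * parity deg (frag_of u)"
      by (subst frag_of_Cons) (rule parity_mult)
    ultimately show ?case
      by (simp add: Cons free_bd_frag_of_Cons frag_of_append algebra_simps)
  qed
  have left: "free_bd deg \<delta> (frag_of u * y) =
      free_bd deg \<delta> (frag_of u) * y + parity deg (frag_of u) * free_bd deg \<delta> y" for u
    by (rule frag_linear_eqI[of "\<lambda>y. free_bd deg \<delta> (frag_of u * y)"])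
      (simp_all add: free_bd_diff right_diff_distrib word)
  show ?thesis
    by (rule frag_linear_eqI[of "\<lambda>x. free_bd deg \<delta> (x * y)"])
      (simp_all add: free_bd_diff parity_diff left algebra_simps)
qed

text \<open>
  A colored, graded ring with a derivation of degree \<open>-1\<close>, in which the composition of arrows is the
  multiplication; products of non-composable elements are irrelevant. The automorphism \<open>\<epsilon>\<close> is
  \<open>(-1)\<^sup>n\<close> in degree \<open>n\<close>.
\<close>

locale dg_ring =
  fixes K :: "color \<Rightarrow> color \<Rightarrow> int \<Rightarrow> 'r::ring_1 set"
    and \<epsilon> d :: "'r \<Rightarrow> 'r"
  assumes zero_closed: "0 \<in> K X Y n"
    and diff_closed: "u \<in> K X Y n \<Longrightarrow> v \<in> K X Y n \<Longrightarrow> u - v \<in> K X Y n"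
    and one_closed: "1 \<in> K X X 0"
    and mult_closed: "u \<in> K Y Z p \<Longrightarrow> v \<in> K X Y q \<Longrightarrow> u * v \<in> K X Z (p + q)"
    and parity_homogeneous: "u \<in> K X Y n \<Longrightarrow> \<epsilon> u = (if even n then u else - u)"
    and d_diff: "d (u - v) = d u - d v"
    and d_mult: "d (u * v) = d u * v + \<epsilon> u * d v"
begin

lemma uminus_closed: "u \<in> K X Y n \<Longrightarrow> - u \<in> K X Y n"
  using diff_closed[OF zero_closed] by fastforce

lemma add_closed: "u \<in> K X Y n \<Longrightarrow> v \<in> K X Y n \<Longrightarrow> u + v \<in> K X Y n"
  using diff_closed[OF _ uminus_closed] by fastforce

lemma sum_closed: "(\<And>i. i \<in> I \<Longrightarrow> f i \<in> K X Y n) \<Longrightarrow> sum f I \<in> K X Y n"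
  by (induction I rule: infinite_finite_induct) (auto intro: zero_closed add_closed)

lemma d_zero: "d 0 = 0"
  using d_diff[of 0 0] by simp

lemma d_uminus: "d (- u) = - d u"
  using d_diff[of 0 u] by (simp add: d_zero)

lemma d_add: "d (u + v) = d u + d v"
  using d_diff[of u "- v"] by (simp add: d_uminus)

lemma d_sum: "d (sum f I) = (\<Sum>i\<in>I. d (f i))"
  by (induction I rule: infinite_finite_induct) (simp_all add: d_zero d_add)

lemma d_one: "d 1 = 0"
  using d_mult[of 1 1] parity_homogeneous[OF one_closed] by simp

end

definition homogeneous ::
    "('s \<Rightarrow> color) \<Rightarrow> ('s \<Rightarrow> color) \<Rightarrow> ('s \<Rightarrow> int) \<Rightarrow> color \<Rightarrow> color \<Rightarrow> int \<Rightarrow> ('s list \<Rightarrow>\<^sub>0 int) set" where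
  "homogeneous s t deg X Y n = {x. Poly_Mapping.keys x \<subseteq> words s t deg X Y n}"

lemma carrier_free_Abelian_group_words:
  "carrier (free_Abelian_group (words s t deg X Y n)) = homogeneous s t deg X Y n"
  by (auto simp: homogeneous_def)

lemma homogeneous_0: "0 \<in> homogeneous s t deg X Y n"
  by (simp add: homogeneous_def)

lemma homogeneous_diff:
  "x \<in> homogeneous s t deg X Y n \<Longrightarrow> y \<in> homogeneous s t deg X Y n \<Longrightarrow> x - y \<in> homogeneous s t deg X Y n"
  using keys_diff[of x y] by (auto simp: homogeneous_def)

lemma homogeneous_frag_of: "frag_of w \<in> homogeneous s t deg X Y n \<longleftrightarrow> w \<in> words s t deg X Y n"
  by (simp add: homogeneous_def)

lemma homogeneous_induct [consumes 1, case_names zero word diff]: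
  assumes "x \<in> homogeneous s t deg X Y n"
    and "P 0"
    and "\<And>w. is_word s t X Y w \<Longrightarrow> word_deg deg w = n \<Longrightarrow> P (frag_of w)"
    and "\<And>x y. \<lbrakk>x \<in> homogeneous s t deg X Y n; y \<in> homogeneous s t deg X Y n; P x; P y\<rbrakk> \<Longrightarrow> P (x - y)"
  shows "P x"
  by (rule free_Abelian_group_induct[of x "words s t deg X Y n"])
    (use assms in \<open>simp_all add: homogeneous_def words_def\<close>)

lemma homogeneous_mult:
  assumes x: "x \<in> homogeneous s t deg Y Z p" and y: "y \<in> homogeneous s t deg X Y q"
  shows "x * y \<in> homogeneous s t deg X Z (p + q)"
proof -
  have "frag_of u * y \<in> homogeneous s t deg X Z (p + q)"
    if "is_word s t Y Z u" "word_deg deg u = p" for u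
    using y
  proof (induction rule: homogeneous_induct)
    case (word v)
    then show ?case
      using that by (simp add: homogeneous_frag_of words_def is_word_append flip: frag_of_append)
  qed (simp_all add: homogeneous_0 homogeneous_diff right_diff_distrib)
  with x show ?thesis
    by (induction rule: homogeneous_induct)
      (simp_all add: homogeneous_0 homogeneous_diff left_diff_distrib)
qed

lemma parity_frag_of: "parity deg (frag_of w) = (if even (word_deg deg w) then frag_of w else - frag_of w)"
  by (simp add: parity_def frag_cmul_ksign)

lemma parity_homogeneous:
  assumes "x \<in> homogeneous s t deg X Y n"
  shows "parity deg x = (if even n then x else - x)"
  using assms
proof (induction rule: homogeneous_induct)
  case zero
  then show ?case by (simp add: parity_def)
qed (auto simp: parity_frag_of parity_diff)

text \<open>All colors and degrees live in the same ring. In particular the one element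
  \<open>1\<close>, the empty word, is the identity of either color.\<close>

lemma free_dg_ring: "dg_ring (homogeneous s t deg) (parity deg) (free_bd deg \<delta>)"
proof
  show "1 \<in> homogeneous s t deg X X 0" for X
    unfolding frag_of_Nil[symmetric] by (simp add: homogeneous_frag_of words_def)
qed (simp_all add: homogeneous_0 homogeneous_diff homogeneous_mult parity_homogeneous free_bd_diff free_bd_mult)

lemma free_bd_frag_of_letter: "free_bd deg \<delta> (frag_of [a]) = \<delta> a"
  by (simp add: free_bd_def concat_prod_eq_times frag_of_Nil)

text \<open>Both conditions concern letters only. The Leibniz rule carries them over to all words,
  so they are what has to be checked for \<open>\<delta>\<close> to define a dg operad.\<close>

locale free_dg =
  fixes s t :: "'s \<Rightarrow> color" and deg :: "'s \<Rightarrow> int" and \<delta> :: "'s \<Rightarrow> 's list \<Rightarrow>\<^sub>0 int"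
  assumes \<delta>_homogeneous: "\<delta> a \<in> homogeneous s t deg (s a) (t a) (deg a - 1)"
    and bd_\<delta>: "free_bd deg \<delta> (\<delta> a) = 0"
begin

sublocale dg_ring "homogeneous s t deg" "parity deg" "free_bd deg \<delta>"
  by (rule free_dg_ring)

lemma letter_closed: "frag_of [a] \<in> homogeneous s t deg (s a) (t a) (deg a)"
  by (simp add: homogeneous_frag_of words_def)

lemma free_bd_closed:
  assumes "x \<in> homogeneous s t deg X Y n"
  shows "free_bd deg \<delta> x \<in> homogeneous s t deg X Y (n - 1)"
  using assms
proof (induction rule: homogeneous_induct)
  case zero
  show ?case by (simp add: d_zero zero_closed)
next
  case (word w)
  then show ?case
  proof (induction w arbitrary: Y n)
    case Nil
    then show ?case by (simp add: frag_of_Nil d_one zero_closed)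
  next
    case (Cons a w)
    define m where "m = word_deg deg w"
    have w: "is_word s t X (s a) w" and Y: "t a = Y" and n: "n = deg a + m"
      using Cons.prems by (auto simp: m_def)
    have "free_bd deg \<delta> (frag_of w) \<in> homogeneous s t deg X (s a) (m - 1)"
      using Cons.IH[OF w] by (simp add: m_def)
    moreover have "parity deg (frag_of [a]) \<in> homogeneous s t deg (s a) Y (deg a)"
      using letter_closed[of a] Y
      by (auto simp: parity_homogeneous[OF letter_closed] intro: uminus_closed)
    ultimately have "parity deg (frag_of [a]) * free_bd deg \<delta> (frag_of w) \<in> homogeneous s t deg X Y (deg a + (m - 1))"
      by (rule mult_closed[rotated])
    moreover have "frag_of w \<in> homogeneous s t deg X (s a) m"
      using w by (simp add: homogeneous_frag_of words_def m_def)
    then have "\<delta> a * frag_of w \<in> homogeneous s t deg X Y (deg a - 1 + m)"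
      using \<delta>_homogeneous[of a] Y by (intro mult_closed) auto
    moreover have "deg a - 1 + m = n - 1" "deg a + (m - 1) = n - 1"
      using n by simp_all
    ultimately show ?case
      by (simp add: free_bd_frag_of_Cons add_closed)
  qed
qed (simp_all add: d_diff diff_closed)

lemma free_bd_parity:
  "x \<in> homogeneous s t deg X Y n \<Longrightarrow> free_bd deg \<delta> (parity deg x) = - parity deg (free_bd deg \<delta> x)"
  using parity_homogeneous[of x X Y n] parity_homogeneous[OF free_bd_closed, of x X Y n]
  by (simp add: d_uminus)

text \<open>On a word \<open>a # w\<close> the two mixed terms are
  \<open>parity deg (\<delta> a)\<close> times the boundary of \<open>w\<close>, with opposite
  signs, since the derivation anticommutes with the parity. The other two terms vanish by
  \<open>bd_\<delta>\<close> and by induction.\<close>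

lemma free_bd_free_bd: "free_bd deg \<delta> (free_bd deg \<delta> x) = 0"
proof (rule frag_linear_eqI[where f = "\<lambda>x. free_bd deg \<delta> (free_bd deg \<delta> x)" and g = "\<lambda>_. 0"])
  show "free_bd deg \<delta> (free_bd deg \<delta> (frag_of w)) = 0" for w
  proof (induction w)
    case Nil
    then show ?case by (simp add: frag_of_Nil d_one d_zero)
  next
    case (Cons a w)
    have "free_bd deg \<delta> (parity deg (frag_of [a])) = - parity deg (\<delta> a)"
      using free_bd_parity[OF letter_closed[of a]] by (simp only: free_bd_frag_of_letter)
    then show ?case
      by (simp only: free_bd_frag_of_Cons[of deg \<delta> a w] d_add d_mult bd_\<delta> Cons) simp
  qed
qed (simp_all add: d_diff)

lemma grp_free_operad [simp]:
  "ops (free_operad s t deg \<delta>) X Y n = free_Abelian_group (words s t deg X Y n)"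
  and bd_free_operad [simp]: "bd (arr (free_operad s t deg \<delta>) X Y) n = free_bd deg \<delta>"
  and cmp_free_operad [simp]: "cmp (free_operad s t deg \<delta>) X Y Z p q u v = u * v"
  and ident_free_operad [simp]: "ident (free_operad s t deg \<delta>) X = 1"
  by (simp_all add: free_operad_def free_bd_def concat_prod_eq_times frag_of_Nil)

lemma colored_operad_free_operad: "colored_operad (free_operad s t deg \<delta>)"
proof (intro colored_operad.intro)
  have [simp]: "Poly_Mapping.keys x \<subseteq> words s t deg X Y n \<longleftrightarrow> x \<in> homogeneous s t deg X Y n" for x X Y n
    by (simp add: homogeneous_def)
  show "chain_complex (arr (free_operad s t deg \<delta>) X Y)" for X Y
    by (intro chain_complex.intro)
      (auto simp: abelian_free_Abelian_group hom_def d_add free_bd_closed add_closed free_bd_free_bd)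
  show "bd (arr (free_operad s t deg \<delta>) X Z) (p + q) (cmp (free_operad s t deg \<delta>) X Y Z p q u v) =
      cmp (free_operad s t deg \<delta>) X Y Z (p - 1) q (bd (arr (free_operad s t deg \<delta>) Y Z) p u) v
        \<otimes>\<^bsub>ops (free_operad s t deg \<delta>) X Z (p + q - 1)\<^esub>
      (cmp (free_operad s t deg \<delta>) X Y Z p (q - 1) u (bd (arr (free_operad s t deg \<delta>) X Y) q v)
        [^]\<^bsub>ops (free_operad s t deg \<delta>) X Z (p + q - 1)\<^esub> ksign p)"
    if "u \<in> carrier (ops (free_operad s t deg \<delta>) Y Z p)" "v \<in> carrier (ops (free_operad s t deg \<delta>) X Y q)"
    for u v X Y Z p q
  proof -
    have "u * free_bd deg \<delta> v \<in> homogeneous s t deg X Z (p + (q - 1))"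
      using that by (intro mult_closed free_bd_closed) auto
    then show ?thesis
      using that by (simp add: frag_cmul_ksign d_mult parity_homogeneous algebra_simps)
  qed
  show "bd (arr (free_operad s t deg \<delta>) X X) 0 (ident (free_operad s t deg \<delta>) X)
      = \<one>\<^bsub>ops (free_operad s t deg \<delta>) X X (- 1)\<^esub>" for X
    by (simp add: d_one)
qed (simp_all add: carrier_free_Abelian_group_words one_closed mult_closed algebra_simps del: carrier_free_Abelian_group_iff)

end

section \<open>The relations of the operad as power series\<close>

text \<open>The right-hand side of the relation for the even series of one letter;
  \<open>fps_X\<close> is the formal variable u. Here \<open>x\<close> and \<open>\<phi>\<close>
  belong to the same letter and \<open>\<gamma>\<close> to the other one, so exchanging the letters
  gives the second relation.\<close>

definition iso_even :: "'r::ring_1 fps \<Rightarrow> 'r fps \<Rightarrow> 'r fps \<Rightarrow> 'r fps" where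
  "iso_even x \<phi> \<gamma> = fps_X * (x * \<phi> - \<gamma> * x)"

definition iso_odd :: "'r::ring_1 fps \<Rightarrow> 'r fps \<Rightarrow> 'r fps \<Rightarrow> 'r fps" where
  "iso_odd x y \<phi> = y * x - 1 - fps_X * (\<phi> * \<phi>)"

definition fps_map :: "('r \<Rightarrow> 'q) \<Rightarrow> 'r fps \<Rightarrow> 'q fps" where
  "fps_map f a = Abs_fps (\<lambda>n. f (fps_nth a n))"

lemma fps_map_nth [simp]: "fps_nth (fps_map f a) n = f (fps_nth a n)"
  by (simp add: fps_map_def)

lemma fps_mult_nth_cong:
  assumes "\<And>i. i \<le> n \<Longrightarrow> fps_nth a i = fps_nth a' i" "\<And>i. i \<le> n \<Longrightarrow> fps_nth b i = fps_nth b' i"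
  shows "fps_nth (a * b) n = fps_nth (a' * b') n"
  using assms by (simp add: fps_mult_nth)

lemma fps_mult_nth_eq_0_left:
  "(\<And>i. i \<le> n \<Longrightarrow> fps_nth a i = 0) \<Longrightarrow> fps_nth (a * b :: 'r::ring_1 fps) n = 0"
  by (simp add: fps_mult_nth)

lemma fps_mult_nth_eq_0_right:
  "(\<And>i. i \<le> n \<Longrightarrow> fps_nth b i = 0) \<Longrightarrow> fps_nth (a * b :: 'r::ring_1 fps) n = 0"
  by (simp add: fps_mult_nth)

lemma fps_mult_nth_top:
  assumes "\<And>i. i < n \<Longrightarrow> fps_nth a i = 0"
  shows "fps_nth (a * b :: 'r::ring_1 fps) n = fps_nth a n * fps_nth b 0"
proof -
  have "fps_nth (a * b) n = (\<Sum>i\<in>{n}. fps_nth a i * fps_nth b (n - i))"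
    unfolding fps_mult_nth using assms by (intro sum.mono_neutral_right) auto
  then show ?thesis by simp
qed

text \<open>The top coefficient of \<open>a\<close> meets only the constant term of
  \<open>b\<close>. Splitting it off leaves a product that involves only earlier coefficients of
  \<open>a\<close>; the recursion uses this to isolate an unknown coefficient.\<close>

lemma fps_mult_nth_cutoff:
  "fps_nth (a * b :: 'r::ring_1 fps) n = fps_nth (fps_cutoff n a * b) n + fps_nth a n * fps_nth b 0"
proof -
  have "fps_nth ((a - fps_cutoff n a) * b) n = fps_nth (a - fps_cutoff n a) n * fps_nth b 0"
    by (rule fps_mult_nth_top) simp
  then show ?thesis by (simp add: algebra_simps)
qed

text \<open>The factor \<open>fps_X\<close> delays everything by one index, so the coefficient at n
  depends on strictly earlier data. This is one half of the well-foundedness of the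
  recursion.\<close>

lemma iso_even_nth_cong:
  assumes "\<And>i. i < n \<Longrightarrow> fps_nth x i = fps_nth x' i" "\<And>i. i < n \<Longrightarrow> fps_nth \<phi> i = fps_nth \<phi>' i"
    "\<And>i. i < n \<Longrightarrow> fps_nth \<gamma> i = fps_nth \<gamma>' i"
  shows "fps_nth (iso_even x \<phi> \<gamma>) n = fps_nth (iso_even x' \<phi>' \<gamma>') n"
proof -
  have "fps_nth (x * \<phi>) (n - 1) = fps_nth (x' * \<phi>') (n - 1)"
    "fps_nth (\<gamma> * x) (n - 1) = fps_nth (\<gamma>' * x') (n - 1)" if "n > 0"
    using assms that by (auto intro!: fps_mult_nth_cong)
  then show ?thesis by (simp add: iso_even_def)
qed

text \<open>Only the square of \<open>\<phi>\<close> is delayed by \<open>fps_X\<close>. The series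
  \<open>x\<close> and \<open>y\<close> enter up to index n itself, which decides the order in which
  the coefficients can be built.\<close>

lemma iso_odd_nth_cong:
  assumes "\<And>i. i \<le> n \<Longrightarrow> fps_nth x i = fps_nth x' i" "\<And>i. i \<le> n \<Longrightarrow> fps_nth y i = fps_nth y' i"
    "\<And>i. i < n \<Longrightarrow> fps_nth \<phi> i = fps_nth \<phi>' i"
  shows "fps_nth (iso_odd x y \<phi>) n = fps_nth (iso_odd x' y' \<phi>') n"
proof -
  have "fps_nth (\<phi> * \<phi>) (n - 1) = fps_nth (\<phi>' * \<phi>') (n - 1)" if "n > 0"
    using assms that by (auto intro!: fps_mult_nth_cong)
  moreover have "fps_nth (y * x) n = fps_nth (y' * x') n"
    using assms by (intro fps_mult_nth_cong)
  ultimately show ?thesis by (simp add: iso_odd_def)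
qed

text \<open>A functional that reads only earlier values is admissible for the order on the natural
  numbers, so \<open>wfrec\<close> provides its fixed point.\<close>

lemma course_of_values_exists:
  fixes \<Phi> :: "(nat \<Rightarrow> 'b) \<Rightarrow> nat \<Rightarrow> 'b"
  assumes "\<And>g h n. (\<And>i. i < n \<Longrightarrow> g i = h i) \<Longrightarrow> \<Phi> g n = \<Phi> h n"
  shows "\<exists>f. \<forall>n. f n = \<Phi> f n"
proof
  have "adm_wf less_than \<Phi>"
    unfolding adm_wf_def by (intro allI impI assms) simp
  then show "\<forall>n. wfrec less_than \<Phi> n = \<Phi> (wfrec less_than \<Phi>) n"
    using fun_cong[OF wfrec_fixpoint[OF wf_less_than]] by blast
qed

section \<open>Bianchi identities, cone contraction and recursive solution of the relations\<close>

context dg_ring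
begin

abbreviation "D \<equiv> fps_map d"
abbreviation "E \<equiv> fps_map \<epsilon>"

lemma D_mult: "D (a * b) = D a * b + E a * D b"
  by (rule fps_ext) (simp add: fps_mult_nth d_sum d_mult sum.distrib)

lemma D_diff: "D (a - b) = D a - D b"
  by (rule fps_ext) (simp add: d_diff)

lemma D_one: "D 1 = 0"
  by (rule fps_ext) (simp add: d_one d_zero)

lemma D_fps_X_mult: "D (fps_X * a) = fps_X * D a"
  by (rule fps_ext) (simp add: d_zero)

text \<open>
  The Bianchi identities: they express the derivative of the right-hand sides of the relations
  through the defects of the relations alone.
\<close>

lemma bianchi:
  assumes "E x = x" "E y = y" "E \<phi> = - \<phi>" "E \<gamma> = - \<gamma>"
  shows "D (x * \<phi> - \<gamma> * x) =
      (D x - iso_even x \<phi> \<gamma>) * \<phi> + x * (D \<phi> - iso_odd x y \<phi>)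
      - (D \<gamma> - iso_odd y x \<gamma>) * x + \<gamma> * (D x - iso_even x \<phi> \<gamma>)"
    and "D (iso_odd x y \<phi>) =
      (D y - iso_even y \<gamma> \<phi>) * x + y * (D x - iso_even x \<phi> \<gamma>)
      + fps_X * (\<phi> * (D \<phi> - iso_odd x y \<phi>) - (D \<phi> - iso_odd x y \<phi>) * \<phi>)"
proof -
  \<comment> \<open>The variable is central although the coefficients do not commute. The rules are
    instantiated at the four series, so that rewriting only moves \<open>fps_X\<close> to the left
    past them.\<close>
  have X: "a * fps_X = fps_X * a" "a * (fps_X * b) = fps_X * (a * b)" for a b :: "'r fps"
    by (metis fps_mult_fps_X_commute mult.assoc)+
  note X = X[of x] X[of y] X[of \<phi>] X[of \<gamma>]
  show "D (x * \<phi> - \<gamma> * x) =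
      (D x - iso_even x \<phi> \<gamma>) * \<phi> + x * (D \<phi> - iso_odd x y \<phi>)
      - (D \<gamma> - iso_odd y x \<gamma>) * x + \<gamma> * (D x - iso_even x \<phi> \<gamma>)"
    by (simp add: D_diff D_mult assms iso_even_def iso_odd_def algebra_simps X)
  have "D (y * x) = D y * x + y * D x" "D (\<phi> * \<phi>) = D \<phi> * \<phi> - \<phi> * D \<phi>"
    by (simp_all add: D_mult assms)
  then have "D (iso_odd x y \<phi>) = D y * x + y * D x - fps_X * (D \<phi> * \<phi> - \<phi> * D \<phi>)"
    by (simp add: iso_odd_def D_diff D_one D_fps_X_mult)
  then show "D (iso_odd x y \<phi>) =
      (D y - iso_even y \<gamma> \<phi>) * x + y * (D x - iso_even x \<phi> \<gamma>)
      + fps_X * (\<phi> * (D \<phi> - iso_odd x y \<phi>) - (D \<phi> - iso_odd x y \<phi>) * \<phi>)"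
    by (simp add: iso_odd_def iso_even_def algebra_simps X)
qed

text \<open>A system \<open>d v = b\<close>, \<open>d w = v * F + r\<close> forces
  \<open>d b = 0\<close> and \<open>d r = - (b * F)\<close>, the cycle conditions in the cone of
  precomposition with \<open>F\<close>. The contraction gives the explicit solution
  \<open>v = b * L - r * G\<close>, \<open>w = b * P - r * H\<close>.\<close>

lemma cone_contraction_even:
  assumes "d F = 0" "d G = 0" "d H = G * F - 1" "d L = F * G - 1" "d P = F * H - L * F"
    and "\<epsilon> r = r" "\<epsilon> b = - b" "d r = - (b * F)" "d b = 0"
  shows "d (b * L - r * G) = b" "d (b * P - r * H) = (b * L - r * G) * F + r"
  by (simp_all add: d_diff d_mult assms algebra_simps)

text \<open>The same with the parities of \<open>r\<close> and \<open>b\<close> exchanged. The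
  second equation of the system is now \<open>d w = - (v * F) - r\<close>, under the same cycle
  conditions.\<close>

lemma cone_contraction_odd:
  assumes "d F = 0" "d G = 0" "d H = G * F - 1" "d L = F * G - 1" "d P = F * H - L * F"
    and "\<epsilon> r = - r" "\<epsilon> b = b" "d r = - (b * F)" "d b = 0"
  shows "d (- (r * G) - b * L) = b" "d (- (r * H) - b * P) = (r * G + b * L) * F - r"
  by (simp_all add: d_diff d_mult d_uminus assms algebra_simps)

text \<open>If the variable is given degree -2, a series with coefficients in degrees
  \<open>2 * int i + p\<close> is homogeneous of degree p, and degrees add under
  multiplication.\<close>

lemma fps_mult_nth_closed:
  assumes "\<And>i. i \<le> n \<Longrightarrow> fps_nth a i \<in> K Y Z (2 * int i + p)"
    and "\<And>i. i \<le> n \<Longrightarrow> fps_nth b i \<in> K X Y (2 * int i + q)"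
  shows "fps_nth (a * b) n \<in> K X Z (2 * int n + p + q)"
  unfolding fps_mult_nth
proof (rule sum_closed)
  fix i assume "i \<in> {0..n}"
  then have "fps_nth a i * fps_nth b (n - i) \<in> K X Z ((2 * int i + p) + (2 * int (n - i) + q))"
    by (intro mult_closed[OF assms]) auto
  moreover have "(2 * int i + p) + (2 * int (n - i) + q) = 2 * int n + p + q"
    using \<open>i \<in> {0..n}\<close> by auto
  ultimately show "fps_nth a i * fps_nth b (n - i) \<in> K X Z (2 * int n + p + q)"
    by metis
qed

lemma iso_even_nth_closed:
  assumes "\<And>i. i < n \<Longrightarrow> fps_nth x i \<in> K X Y (2 * int i)"
    and "\<And>i. i < n \<Longrightarrow> fps_nth \<phi> i \<in> K X X (2 * int i + 1)"
    and "\<And>i. i < n \<Longrightarrow> fps_nth \<gamma> i \<in> K Y Y (2 * int i + 1)"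
  shows "fps_nth (iso_even x \<phi> \<gamma>) n \<in> K X Y (2 * int n - 1)"
proof (cases n)
  case (Suc m)
  have "fps_nth (x * \<phi>) m \<in> K X Y (2 * int m + 0 + 1)"
    by (rule fps_mult_nth_closed[where Y = X]) (simp_all add: assms Suc)
  moreover have "fps_nth (\<gamma> * x) m \<in> K X Y (2 * int m + 1 + 0)"
    by (rule fps_mult_nth_closed[where Y = Y]) (simp_all add: assms Suc)
  ultimately show ?thesis
    by (simp add: iso_even_def Suc diff_closed add.commute)
qed (simp add: iso_even_def zero_closed)

lemma iso_odd_nth_closed:
  assumes "\<And>i. i \<le> n \<Longrightarrow> fps_nth x i \<in> K X Y (2 * int i)"
    and "\<And>i. i \<le> n \<Longrightarrow> fps_nth y i \<in> K Y X (2 * int i)"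
    and "\<And>i. i < n \<Longrightarrow> fps_nth \<phi> i \<in> K X X (2 * int i + 1)"
  shows "fps_nth (iso_odd x y \<phi>) n \<in> K X X (2 * int n)"
proof -
  have "fps_nth (y * x) n \<in> K X X (2 * int n + 0 + 0)"
    by (rule fps_mult_nth_closed[where Y = Y]) (simp_all add: assms)
  moreover have "fps_nth (1 :: 'r fps) n \<in> K X X (2 * int n)"
    by (simp add: fps_one_nth one_closed zero_closed)
  moreover have "fps_nth (fps_X * (\<phi> * \<phi>)) n \<in> K X X (2 * int n)"
  proof (cases n)
    case (Suc m)
    have "fps_nth (\<phi> * \<phi>) m \<in> K X X (2 * int m + 1 + 1)"
      by (rule fps_mult_nth_closed[where Y = X]) (simp_all add: assms Suc)
    then show ?thesis by (simp add: Suc)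
  qed (simp add: zero_closed)
  ultimately show ?thesis
    by (simp add: iso_odd_def diff_closed)
qed

text \<open>
  The series are found coefficient by coefficient. The pairs \<open>(y\<^sub>m, \<phi>\<^sub>m)\<close> and \<open>(\<gamma>\<^sub>m, x\<^sub>m\<^sub>+\<^sub>1)\<close> are
  obtained from the earlier coefficients by applying the contraction of the mapping cone of \<open>F\<close>
  given by \<open>G\<close>, \<open>H\<close>, \<open>L\<close>, \<open>P\<close>; the Bianchi identities say that it is applied to a cycle.
\<close>

lemma iso_series_exist:
  assumes F: "F \<in> K B W 0" and G: "G \<in> K W B 0" and H: "H \<in> K B B 1" and L: "L \<in> K W W 1"
    and P: "P \<in> K B W 2"
    and dF: "d F = 0" and dG: "d G = 0" and dH: "d H = G * F - 1" and dL: "d L = F * G - 1"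
    and dP: "d P = F * H - L * F"
  obtains x y \<phi> \<gamma> where
    "fps_nth x 0 = F" "fps_nth y 0 = G" "fps_nth \<phi> 0 = H" "fps_nth \<gamma> 0 = L"
    "\<And>n. fps_nth x n \<in> K B W (2 * int n)" "\<And>n. fps_nth y n \<in> K W B (2 * int n)"
    "\<And>n. fps_nth \<phi> n \<in> K B B (2 * int n + 1)" "\<And>n. fps_nth \<gamma> n \<in> K W W (2 * int n + 1)"
    "D x = iso_even x \<phi> \<gamma>" "D y = iso_even y \<gamma> \<phi>" "D \<phi> = iso_odd x y \<phi>" "D \<gamma> = iso_odd y x \<gamma>"
proof -
  \<comment> \<open>One sequence of pairs holds all four series in the order of construction: index
    \<open>2 * m\<close> carries the coefficients m of y and \<open>\<phi>\<close>, index
    \<open>2 * m + 1\<close> the coefficient m of \<open>\<gamma>\<close> and the coefficient m + 1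
    of x. The constant term of x is prescribed as \<open>F\<close>.\<close>
  define xs where "xs h = Abs_fps (\<lambda>n. if n = 0 then F else snd (h (2 * n - 1)))" for h :: "nat \<Rightarrow> 'r \<times> 'r"
  define ys where "ys h = Abs_fps (\<lambda>n. fst (h (2 * n)))" for h :: "nat \<Rightarrow> 'r \<times> 'r"
  define phs where "phs h = Abs_fps (\<lambda>n. snd (h (2 * n)))" for h :: "nat \<Rightarrow> 'r \<times> 'r"
  define gas where "gas h = Abs_fps (\<lambda>n. fst (h (2 * n + 1)))" for h :: "nat \<Rightarrow> 'r \<times> 'r"
  \<comment> \<open>The relations at m ask that the new coefficient v of y have boundary b and that
    the new coefficient of \<open>\<phi>\<close> have boundary \<open>v * F + r\<close>. Cutting y
    off at m keeps v out of r, so the even contraction formula applies.\<close>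
  define evstep where "evstep h m =
      (let b = fps_nth (iso_even (ys h) (gas h) (phs h)) m;
           r = fps_nth (iso_odd (xs h) (fps_cutoff m (ys h)) (phs h)) m
       in (b * L - r * G, b * P - r * H))" for h m
  \<comment> \<open>The coefficients of x and \<open>\<phi>\<close> up to m are known by now, so
    only \<open>\<gamma>\<close> is cut off. The sign of r is chosen to fit the odd contraction
    formula.\<close>
  define odstep where "odstep h m =
      (let b = fps_nth (iso_odd (ys h) (xs h) (gas h)) m;
           r = - fps_nth (xs h * phs h - fps_cutoff m (gas h) * xs h) m
       in (- (r * G) - b * L, - (r * H) - b * P))" for h m
  \<comment> \<open>At index 0 the even step has b = 0 and r = -1, so it returns
    \<open>(G, H)\<close> by itself. At index 1 the pair \<open>(L, P)\<close> is prescribed; the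
    odd step starts at m = 1.\<close>
  define \<Phi> where "\<Phi> h k =
      (if even k then evstep h (k div 2) else if k = 1 then (L, P) else odstep h (k div 2))" for h k
  have "\<exists>h. \<forall>k. h k = \<Phi> h k"
  proof (rule course_of_values_exists)
    fix g h :: "nat \<Rightarrow> 'r \<times> 'r" and k
    assume eq: "\<And>i. i < k \<Longrightarrow> g i = h i"
    have "evstep g m = evstep h m" if k: "k = 2 * m" for m
    proof -
      have "fps_nth (iso_even (ys g) (gas g) (phs g)) m = fps_nth (iso_even (ys h) (gas h) (phs h)) m"
        by (rule iso_even_nth_cong) (auto simp: k ys_def gas_def phs_def eq)
      moreover have "fps_nth (iso_odd (xs g) (fps_cutoff m (ys g)) (phs g)) m
          = fps_nth (iso_odd (xs h) (fps_cutoff m (ys h)) (phs h)) m"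
        by (rule iso_odd_nth_cong) (auto simp: k xs_def ys_def phs_def eq)
      ultimately show ?thesis by (simp add: evstep_def)
    qed
    moreover have "odstep g m = odstep h m" if k: "k = 2 * m + 1" for m
    proof -
      have "fps_nth (iso_odd (ys g) (xs g) (gas g)) m = fps_nth (iso_odd (ys h) (xs h) (gas h)) m"
        by (rule iso_odd_nth_cong) (auto simp: k xs_def ys_def gas_def eq)
      moreover have "fps_nth (xs g * phs g) m = fps_nth (xs h * phs h) m"
        by (rule fps_mult_nth_cong) (auto simp: k xs_def phs_def eq)
      moreover have "fps_nth (fps_cutoff m (gas g) * xs g) m = fps_nth (fps_cutoff m (gas h) * xs h) m"
        by (rule fps_mult_nth_cong) (auto simp: k xs_def gas_def eq)
      ultimately show ?thesis by (simp add: odstep_def)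
    qed
    ultimately show "\<Phi> g k = \<Phi> h k"
      unfolding \<Phi>_def by (auto elim!: evenE oddE)
  qed
  then obtain h where h: "\<And>k. h k = \<Phi> h k" by blast
  define x y \<phi> \<gamma> where "x = xs h" and "y = ys h" and "\<phi> = phs h" and "\<gamma> = gas h"
  define e where "e m = fps_nth (iso_even y \<gamma> \<phi>) m" for m
  define r where "r m = fps_nth (iso_odd x (fps_cutoff m y) \<phi>) m" for m
  define e' where "e' m = fps_nth (iso_odd y x \<gamma>) m" for m
  define r' where "r' m = - fps_nth (x * \<phi> - fps_cutoff m \<gamma> * x) m" for m
  have x0: "fps_nth x 0 = F"
    by (simp add: x_def xs_def)
  have ev: "(fps_nth y m, fps_nth \<phi> m) = (e m * L - r m * G, e m * P - r m * H)" for m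
    using h[of "2 * m"]
    by (simp add: \<Phi>_def evstep_def Let_def e_def r_def x_def y_def \<phi>_def \<gamma>_def prod_eq_iff)
      (simp add: ys_def phs_def)
  have od: "(fps_nth \<gamma> m, fps_nth x (Suc m)) = (- (r' m * G) - e' m * L, - (r' m * H) - e' m * P)"
    if "m > 0" for m
    using h[of "2 * m + 1"] that
    by (simp add: \<Phi>_def odstep_def Let_def e'_def r'_def x_def y_def \<phi>_def \<gamma>_def prod_eq_iff)
      (simp add: xs_def gas_def)
  have od0: "fps_nth \<gamma> 0 = L" "fps_nth x 1 = P"
    using h[of 1] by (simp_all add: \<Phi>_def \<gamma>_def gas_def x_def xs_def)
  have ev0: "fps_nth y 0 = G" "fps_nth \<phi> 0 = H"
    using ev[of 0] by (simp_all add: e_def r_def iso_even_def iso_odd_def)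

  have closed: "(\<forall>m. k = 2 * m \<longrightarrow> fps_nth y m \<in> K W B (2 * int m) \<and> fps_nth \<phi> m \<in> K B B (2 * int m + 1) \<and>
        e m \<in> K W B (2 * int m - 1) \<and> r m \<in> K B B (2 * int m)) \<and>
      (\<forall>m. k = 2 * m + 1 \<longrightarrow> fps_nth \<gamma> m \<in> K W W (2 * int m + 1) \<and> fps_nth x (m + 1) \<in> K B W (2 * int m + 2) \<and>
        e' m \<in> K W W (2 * int m) \<and> r' m \<in> K B W (2 * int m + 1))" for k
  proof (induction k rule: less_induct)
    case (less k)
    have y: "fps_nth y i \<in> K W B (2 * int i)" and \<phi>: "fps_nth \<phi> i \<in> K B B (2 * int i + 1)" if "2 * i < k" for i
      using less[OF that] by auto
    have \<gamma>: "fps_nth \<gamma> i \<in> K W W (2 * int i + 1)" if "2 * i + 1 < k" for i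
      using less[OF that] by auto
    \<comment> \<open>The bound is not strict for x: its coefficient i is built at stage 2i - 1, or
      prescribed if i = 0, and stage 2i already uses it.\<close>
    have x: "fps_nth x i \<in> K B W (2 * int i)" if "2 * i \<le> k" for i
    proof (cases i)
      case 0
      then show ?thesis using F by (simp add: x0)
    next
      case (Suc j)
      then show ?thesis using less[of "2 * j + 1"] that by (auto simp: algebra_simps)
    qed
    have even: "fps_nth y m \<in> K W B (2 * int m) \<and> fps_nth \<phi> m \<in> K B B (2 * int m + 1) \<and>
        e m \<in> K W B (2 * int m - 1) \<and> r m \<in> K B B (2 * int m)" if k: "k = 2 * m" for m
    proof -
      have e: "e m \<in> K W B (2 * int m - 1)"
        unfolding e_def by (rule iso_even_nth_closed) (auto simp: k y \<phi> \<gamma>)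
      have r: "r m \<in> K B B (2 * int m)"
        unfolding r_def by (rule iso_odd_nth_closed[where Y = W]) (auto simp: k y \<phi> x zero_closed)
      show ?thesis
        using ev[of m] e r diff_closed mult_closed[OF e L] mult_closed[OF r G] mult_closed[OF e P] mult_closed[OF r H]
        by (simp add: add.commute)
    qed
    have odd: "fps_nth \<gamma> m \<in> K W W (2 * int m + 1) \<and> fps_nth x (m + 1) \<in> K B W (2 * int m + 2) \<and>
        e' m \<in> K W W (2 * int m) \<and> r' m \<in> K B W (2 * int m + 1)" if k: "k = 2 * m + 1" for m
    proof -
      have e: "e' m \<in> K W W (2 * int m)"
        unfolding e'_def by (rule iso_odd_nth_closed[where Y = B]) (auto simp: k y \<gamma> x)
      have "fps_nth (x * \<phi>) m \<in> K B W (2 * int m + 0 + 1)"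
        by (rule fps_mult_nth_closed[where Y = B]) (auto simp: k x \<phi>)
      moreover have "fps_nth (fps_cutoff m \<gamma> * x) m \<in> K B W (2 * int m + 1 + 0)"
        by (rule fps_mult_nth_closed[where Y = W]) (auto simp: k x \<gamma> zero_closed)
      ultimately have r: "r' m \<in> K B W (2 * int m + 1)"
        by (simp add: r'_def uminus_closed diff_closed del: minus_diff_eq)
      show ?thesis
      proof (cases "m = 0")
        case True
        then show ?thesis using e r L P by (simp add: od0[unfolded One_nat_def])
      next
        case False
        then show ?thesis
          using od[of m] e r diff_closed uminus_closed mult_closed[OF e L] mult_closed[OF r G]
            mult_closed[OF e P] mult_closed[OF r H]
          by (simp add: add.commute)
      qed
    qed
    show ?case using even odd by blast
  qed
  have xK: "fps_nth x m \<in> K B W (2 * int m)" for m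
    using closed[of "2 * (m - 1) + 1"] F by (cases m) (auto simp: x0 algebra_simps)
  have yK: "fps_nth y m \<in> K W B (2 * int m)" and \<phi>K: "fps_nth \<phi> m \<in> K B B (2 * int m + 1)"
    and \<gamma>K: "fps_nth \<gamma> m \<in> K W W (2 * int m + 1)" for m
    using closed[of "2 * m"] closed[of "2 * m + 1"] by auto
  have \<epsilon>: "\<epsilon> (e m) = - e m" "\<epsilon> (r m) = r m" "\<epsilon> (e' m) = e' m" "\<epsilon> (r' m) = - r' m" for m
    using closed[of "2 * m"] closed[of "2 * m + 1"] by (auto simp: parity_homogeneous)
  have E: "E x = x" "E y = y" "E \<phi> = - \<phi>" "E \<gamma> = - \<gamma>"
    by (auto intro!: fps_ext simp: parity_homogeneous[OF xK] parity_homogeneous[OF yK]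
        parity_homogeneous[OF \<phi>K] parity_homogeneous[OF \<gamma>K])
  \<comment> \<open>The defects of the four relations. They are shown to vanish in the order in
    which the coefficients were built.\<close>
  define Ex Ey E\<phi> E\<gamma> where "Ex = D x - iso_even x \<phi> \<gamma>" and "Ey = D y - iso_even y \<gamma> \<phi>"
    and "E\<phi> = D \<phi> - iso_odd x y \<phi>" and "E\<gamma> = D \<gamma> - iso_odd y x \<gamma>"
  note bianchi_xy = bianchi[OF E(1,2,3,4), folded Ex_def Ey_def E\<phi>_def E\<gamma>_def]
  note bianchi_yx = bianchi[OF E(2,1,4,3), folded Ex_def Ey_def E\<phi>_def E\<gamma>_def]
  have defects: "(\<forall>m. k = 2 * m \<longrightarrow> fps_nth Ey m = 0 \<and> fps_nth E\<phi> m = 0) \<and>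
      (\<forall>m. k = 2 * m + 1 \<longrightarrow> fps_nth E\<gamma> m = 0 \<and> fps_nth Ex (m + 1) = 0)" for k
  proof (induction k rule: less_induct)
    case (less k)
    have y: "fps_nth Ey i = 0" and \<phi>: "fps_nth E\<phi> i = 0" if "2 * i < k" for i
      using less[OF that] by auto
    have \<gamma>: "fps_nth E\<gamma> i = 0" if "2 * i + 1 < k" for i
      using less[OF that] by auto
    have x: "fps_nth Ex i = 0" if "2 * i \<le> k" for i
    proof (cases i)
      case 0
      then show ?thesis by (simp add: Ex_def x0 dF iso_even_def)
    next
      case (Suc j)
      then show ?thesis using less[of "2 * j + 1"] that by auto
    qed
    have even: "fps_nth Ey m = 0 \<and> fps_nth E\<phi> m = 0" if k: "k = 2 * m" for m
    proof -
      \<comment> \<open>At index m - 1 every defect in the Bianchi identity belongs to an earlier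
        stage.\<close>
      have de: "d (e m) = 0"
      proof (cases m)
        case 0
        then show ?thesis by (simp add: e_def iso_even_def d_zero)
      next
        case (Suc j)
        have "d (e m) = fps_nth (D (y * \<gamma> - \<phi> * y)) j"
          by (simp add: e_def iso_even_def Suc)
        also have "\<dots> = 0"
          unfolding bianchi_yx using Suc
          by (simp add: fps_mult_nth_eq_0_left fps_mult_nth_eq_0_right k y \<phi> \<gamma>)
        finally show ?thesis .
      qed
      have r: "fps_nth (iso_odd x y \<phi>) m = r m + fps_nth y m * F"
        by (simp add: r_def iso_odd_def x0 fps_mult_nth_cutoff[of y x])
      \<comment> \<open>In this Bianchi identity at index m, only the defect of y at m is not yet
        known to vanish. As its lower coefficients are zero, it meets just the constant term
        \<open>F\<close> of x.\<close>
      have "fps_nth (D (iso_odd x y \<phi>)) m = fps_nth Ey m * F"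
      proof -
        have "fps_nth (fps_X * (\<phi> * E\<phi> - E\<phi> * \<phi>)) m = 0"
          by (cases m) (simp_all add: fps_mult_nth_eq_0_left fps_mult_nth_eq_0_right k \<phi>)
        moreover have "fps_nth (Ey * x) m = fps_nth Ey m * F"
          using fps_mult_nth_top[of m Ey x] y k by (simp add: x0)
        moreover have "fps_nth (y * Ex) m = 0"
          by (rule fps_mult_nth_eq_0_right) (simp add: x k)
        ultimately show ?thesis
          unfolding bianchi_xy by simp
      qed
      \<comment> \<open>The boundary of the new coefficient of y occurs on both sides and cancels.
        The second cycle condition is thus available before that boundary is known.\<close>
      then have "d (r m) + d (fps_nth y m) * F = (d (fps_nth y m) - e m) * F"
        by (simp add: r d_add d_mult Ey_def e_def dF)
      then have dr: "d (r m) = - (e m * F)"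
        by (simp add: algebra_simps eq_neg_iff_add_eq_0)
      note cc = cone_contraction_even[OF dF dG dH dL dP \<epsilon>(2,1) dr de]
      show ?thesis
        using cc ev[of m] by (simp add: Ey_def E\<phi>_def r e_def[symmetric] add.commute)
    qed
    have odd: "fps_nth E\<gamma> m = 0 \<and> fps_nth Ex (m + 1) = 0" if k: "k = 2 * m + 1" for m
    proof (cases "m = 0")
      \<comment> \<open>The first odd stage is the pair of given equations for \<open>d L\<close>
        and \<open>d P\<close>.\<close>
      case True
      then show ?thesis
        using od0 by (simp add: E\<gamma>_def Ex_def dL dP iso_even_def iso_odd_def x0 ev0)
    next
      case False
      have de: "d (e' m) = 0"
      proof -
        have "fps_nth (fps_X * (\<gamma> * E\<gamma> - E\<gamma> * \<gamma>)) m = 0"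
          by (cases m) (simp_all add: fps_mult_nth_eq_0_left fps_mult_nth_eq_0_right k \<gamma>)
        moreover have "fps_nth (Ex * y) m = 0"
          by (rule fps_mult_nth_eq_0_left) (simp add: x k)
        moreover have "fps_nth (x * Ey) m = 0"
          by (rule fps_mult_nth_eq_0_right) (simp add: y k)
        moreover have "d (e' m) = fps_nth (D (iso_odd y x \<gamma>)) m"
          by (simp add: e'_def)
        ultimately show ?thesis
          unfolding bianchi_yx by simp
      qed
      have r: "fps_nth (x * \<phi> - \<gamma> * x) m = - r' m - fps_nth \<gamma> m * F"
        by (simp add: r'_def x0 fps_mult_nth_cutoff[of \<gamma> x])
      \<comment> \<open>As at the even stages, the one surviving term is the defect still to be
        treated, here that of \<open>\<gamma>\<close> at m, times \<open>F\<close>.\<close>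
      have "fps_nth (D (x * \<phi> - \<gamma> * x)) m = - (fps_nth E\<gamma> m * F)"
      proof -
        have "fps_nth (E\<gamma> * x) m = fps_nth E\<gamma> m * F"
          using fps_mult_nth_top[of m E\<gamma> x] \<gamma> k by (simp add: x0)
        then show ?thesis
          unfolding bianchi_xy
          by (simp add: fps_mult_nth_eq_0_left fps_mult_nth_eq_0_right x \<phi> k)
      qed
      then have "- d (r' m) - d (fps_nth \<gamma> m) * F = - ((d (fps_nth \<gamma> m) - e' m) * F)"
        by (simp only: fps_map_nth r d_diff d_uminus d_mult dF) (simp add: E\<gamma>_def e'_def)
      then have "- d (r' m) = e' m * F"
        by (simp add: algebra_simps)
      then have dr: "d (r' m) = - (e' m * F)"
        by (metis minus_minus)
      note cc = cone_contraction_odd[OF dF dG dH dL dP \<epsilon>(4,3) dr de]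
      have step: "fps_nth \<gamma> m = - (r' m * G) - e' m * L" "fps_nth x (Suc m) = - (r' m * H) - e' m * P"
        using od[of m] False by auto
      have "r' m * G + e' m * L = - fps_nth \<gamma> m"
        by (simp add: step)
      then have "d (fps_nth x (Suc m)) = fps_nth (x * \<phi> - \<gamma> * x) m"
        unfolding r by (simp add: cc(2) step(2))
      moreover have "d (fps_nth \<gamma> m) = e' m"
        using cc(1) by (simp add: step(1))
      ultimately show ?thesis
        by (simp add: E\<gamma>_def Ex_def e'_def[symmetric] iso_even_def)
    qed
    show ?case using even odd by blast
  qed
  have "fps_nth Ex m = 0" for m
    using defects[of "2 * (m - 1) + 1"] by (cases m) (auto simp: Ex_def x0 dF iso_even_def)
  moreover have "fps_nth Ey m = 0" "fps_nth E\<phi> m = 0" "fps_nth E\<gamma> m = 0" for m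
    using defects[of "2 * m"] defects[of "2 * m + 1"] by auto
  ultimately have "Ex = 0" "Ey = 0" "E\<phi> = 0" "E\<gamma> = 0"
    by (auto intro: fps_ext)
  then show thesis
    using that[of x y \<phi> \<gamma>] x0 ev0 od0(1) xK yK \<phi>K \<gamma>K
    by (simp add: Ex_def Ey_def E\<phi>_def E\<gamma>_def)
qed

end

section \<open>The relations for ring elements in place of letters, and their power series
  form\<close>

definition iso_rel :: "(nat \<Rightarrow> 'r::ring_1) \<Rightarrow> (nat \<Rightarrow> 'r) \<Rightarrow> nat \<Rightarrow> 'r" where
  "iso_rel a b n =
     (if n = 0 then 0
      else if n = 1 then b 0 * a 0 - 1
      else if even n then
        (let m = n div 2 in \<Sum>i<m. a (2 * i) * a (2 * (m - i) - 1) - b (2 * (m - i) - 1) * a (2 * i))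
      else
        (let m = n div 2 in
          (\<Sum>j\<le>m. b (2 * j) * a (2 * (m - j))) - (\<Sum>j<m. a (2 * j + 1) * a (2 * (m - j) - 1))))"

lemma frag_of_pair: "frag_of [a, b] = frag_of [a] * frag_of [b]"
  by (rule frag_of_Cons)

lemma iso_bd_gen_eq_iso_rel:
  "iso_bd_gen x y n = iso_rel (\<lambda>i. frag_of [x i]) (\<lambda>i. frag_of [y i]) n"
  by (simp add: iso_bd_gen_def iso_rel_def frag_of_pair frag_of_Nil Let_def)

definition evens :: "(nat \<Rightarrow> 'r) \<Rightarrow> 'r fps" where "evens a = Abs_fps (\<lambda>i. a (2 * i))"
definition odds :: "(nat \<Rightarrow> 'r) \<Rightarrow> 'r fps" where "odds a = Abs_fps (\<lambda>i. a (2 * i + 1))"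

lemma evens_nth [simp]: "fps_nth (evens a) i = a (2 * i)"
  and odds_nth [simp]: "fps_nth (odds a) i = a (2 * i + 1)"
  by (simp_all add: evens_def odds_def)

lemma iso_rel_even: "iso_rel a b (2 * m) = fps_nth (iso_even (evens a) (odds a) (odds b)) m"
proof (cases m)
  case 0
  then show ?thesis by (simp add: iso_rel_def iso_even_def)
next
  case (Suc k)
  have idx: "2 * (m - i) - 1 = 2 * (k - i) + 1" if "i \<le> k" for i
    using that Suc by auto
  have "iso_rel a b (2 * m) = (\<Sum>i\<le>k. a (2 * i) * a (2 * (k - i) + 1) - b (2 * (k - i) + 1) * a (2 * i))"
    unfolding iso_rel_def using Suc
    by (auto simp: Let_def lessThan_Suc_atMost idx[unfolded Suc, simplified] intro!: sum.cong)
  also have "\<dots> = fps_nth (evens a * odds a) k - (\<Sum>i\<le>k. b (2 * (k - i) + 1) * a (2 * i))"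
    by (simp add: sum_subtractf fps_mult_nth atLeast0AtMost)
  \<comment> \<open>Reversing the summation index turns this sum into a Cauchy product whose first
    factor is the odd series; the order of the factors is kept.\<close>
  also have "(\<Sum>i\<le>k. b (2 * (k - i) + 1) * a (2 * i)) = fps_nth (odds b * evens a) k"
    using sum.nat_diff_reindex[of "\<lambda>i. b (2 * i + 1) * a (2 * (k - i))" "Suc k"]
    by (simp add: fps_mult_nth atLeast0AtMost lessThan_Suc_atMost)
  finally show ?thesis
    by (simp add: iso_even_def Suc)
qed

text \<open>The exceptional relation in index 1 is the coefficient at 0: the constant series in
  \<open>iso_odd\<close> contributes its -1 only there.\<close>

lemma iso_rel_odd: "iso_rel a b (2 * m + 1) = fps_nth (iso_odd (evens a) (evens b) (odds a)) m"
proof (cases m)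
  case 0
  then show ?thesis by (simp add: iso_rel_def iso_odd_def)
next
  case (Suc k)
  have "(\<Sum>j<m. a (2 * j + 1) * a (2 * (m - j) - 1)) = fps_nth (odds a * odds a) k"
    by (auto simp: fps_mult_nth Suc atLeast0AtMost lessThan_Suc_atMost Suc_diff_le intro!: sum.cong)
  moreover have "(\<Sum>j\<le>m. b (2 * j) * a (2 * (m - j))) = fps_nth (evens b * evens a) m"
    by (simp add: fps_mult_nth atLeast0AtMost)
  ultimately show ?thesis
    by (simp add: iso_rel_def iso_odd_def Suc)
qed

text \<open>The ring homomorphism between word rings determined by the images
  \<open>\<alpha>\<close> of the letters, defined on the whole ring without reference to colors or
  degrees.\<close>

definition subst :: "('s \<Rightarrow> 'q list \<Rightarrow>\<^sub>0 int) \<Rightarrow> ('s list \<Rightarrow>\<^sub>0 int) \<Rightarrow> 'q list \<Rightarrow>\<^sub>0 int" where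
  "subst \<alpha> = frag_extend (\<lambda>w. prod_list (map \<alpha> w))"

lemma subst_diff: "subst \<alpha> (x - y) = subst \<alpha> x - subst \<alpha> y"
  and subst_sum: "finite I \<Longrightarrow> subst \<alpha> (\<Sum>i\<in>I. f i) = (\<Sum>i\<in>I. subst \<alpha> (f i))"
  and subst_frag_of: "subst \<alpha> (frag_of w) = prod_list (map \<alpha> w)"
  by (simp_all add: subst_def frag_extend_diff frag_extend_sum o_def)

lemma subst_0: "subst \<alpha> 0 = 0"
  by (simp add: subst_def)

lemma subst_1: "subst \<alpha> 1 = 1"
  using subst_frag_of[of \<alpha> "[]"] by (simp add: frag_of_Nil)

lemma subst_mult: "subst \<alpha> (x * y) = subst \<alpha> x * subst \<alpha> y"
proof -
  have left: "subst \<alpha> (frag_of u * y) = subst \<alpha> (frag_of u) * subst \<alpha> y" for u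
    by (rule frag_linear_eqI[of "\<lambda>y. subst \<alpha> (frag_of u * y)"])
      (simp_all add: subst_diff right_diff_distrib, simp add: subst_frag_of flip: frag_of_append)
  show ?thesis
    by (rule frag_linear_eqI[of "\<lambda>x. subst \<alpha> (x * y)"])
      (simp_all add: subst_diff left_diff_distrib left)
qed

lemma subst_iso_rel: "subst \<alpha> (iso_rel a b n) = iso_rel (\<lambda>i. subst \<alpha> (a i)) (\<lambda>i. subst \<alpha> (b i)) n"
  by (simp add: iso_rel_def Let_def subst_0 subst_1 subst_diff subst_mult subst_sum)

section \<open>The differential of \<open>R_iso\<close> squares to zero\<close>

interpretation R_iso: dg_ring "homogeneous iso_src iso_tgt iso_deg" "parity iso_deg" "free_bd iso_deg iso_bd"
  by (rule free_dg_ring)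

abbreviation (input) "f_gen i \<equiv> frag_of [Fg i]"
abbreviation (input) "g_gen i \<equiv> frag_of [Gg i]"

lemma D_iso_gens:
  "R_iso.D (evens f_gen) = iso_even (evens f_gen) (odds f_gen) (odds g_gen)"
  "R_iso.D (evens g_gen) = iso_even (evens g_gen) (odds g_gen) (odds f_gen)"
  "R_iso.D (odds f_gen) = iso_odd (evens f_gen) (evens g_gen) (odds f_gen)"
  "R_iso.D (odds g_gen) = iso_odd (evens g_gen) (evens f_gen) (odds g_gen)"
  by (auto intro!: fps_ext simp: free_bd_frag_of_letter iso_bd_gen_eq_iso_rel
      iso_rel_even simp flip: iso_rel_odd[unfolded Suc_eq_plus1[symmetric]])

lemma iso_gens_homogeneous:
  "f_gen (2 * i) \<in> homogeneous iso_src iso_tgt iso_deg B W (2 * int i)"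
  "g_gen (2 * i) \<in> homogeneous iso_src iso_tgt iso_deg W B (2 * int i)"
  "f_gen (2 * i + 1) \<in> homogeneous iso_src iso_tgt iso_deg B B (2 * int i + 1)"
  "g_gen (2 * i + 1) \<in> homogeneous iso_src iso_tgt iso_deg W W (2 * int i + 1)"
  by (simp_all add: homogeneous_frag_of words_def)

lemma iso_bd_cases:
  "iso_bd (Fg (2 * m)) = fps_nth (iso_even (evens f_gen) (odds f_gen) (odds g_gen)) m"
  "iso_bd (Gg (2 * m)) = fps_nth (iso_even (evens g_gen) (odds g_gen) (odds f_gen)) m"
  "iso_bd (Fg (2 * m + 1)) = fps_nth (iso_odd (evens f_gen) (evens g_gen) (odds f_gen)) m"
  "iso_bd (Gg (2 * m + 1)) = fps_nth (iso_odd (evens g_gen) (evens f_gen) (odds g_gen)) m"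
  by (simp_all only: iso_bd.simps iso_bd_gen_eq_iso_rel iso_rel_even iso_rel_odd)

lemma iso_gen_parity_cases:
  obtains m where "a = Fg (2 * m)" | m where "a = Fg (2 * m + 1)"
    | m where "a = Gg (2 * m)" | m where "a = Gg (2 * m + 1)"
  by (cases a) (metis evenE oddE)+

text \<open>The series formed by the generators satisfy the relations by definition of the
  differential. All defects in the Bianchi identities are therefore zero, and the right-hand sides
  are cycles. The Bianchi identities rest on the Leibniz rule alone, so the argument is not
  circular.\<close>

interpretation R_iso: free_dg iso_src iso_tgt iso_deg iso_bd
proof
  have E: "R_iso.E (evens f_gen) = evens f_gen" "R_iso.E (evens g_gen) = evens g_gen"
    "R_iso.E (odds f_gen) = - odds f_gen" "R_iso.E (odds g_gen) = - odds g_gen"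
    by (auto intro!: fps_ext simp: parity_frag_of)
  fix a
  show "iso_bd a \<in> homogeneous iso_src iso_tgt iso_deg (iso_src a) (iso_tgt a) (iso_deg a - 1)"
  proof (cases a rule: iso_gen_parity_cases)
    case (1 m)
    have "iso_bd a \<in> homogeneous iso_src iso_tgt iso_deg B W (2 * int m - 1)"
      unfolding 1 iso_bd_cases
      by (rule R_iso.iso_even_nth_closed) (simp_all only: evens_nth odds_nth iso_gens_homogeneous)
    then show ?thesis by (simp add: 1)
  next
    case (2 m)
    have "iso_bd a \<in> homogeneous iso_src iso_tgt iso_deg B B (2 * int m)"
      unfolding 2 iso_bd_cases
      by (rule R_iso.iso_odd_nth_closed[where Y = W]) (simp_all only: evens_nth odds_nth iso_gens_homogeneous)
    then show ?thesis by (simp add: 2)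
  next
    case (3 m)
    have "iso_bd a \<in> homogeneous iso_src iso_tgt iso_deg W B (2 * int m - 1)"
      unfolding 3 iso_bd_cases
      by (rule R_iso.iso_even_nth_closed) (simp_all only: evens_nth odds_nth iso_gens_homogeneous)
    then show ?thesis by (simp add: 3)
  next
    case (4 m)
    have "iso_bd a \<in> homogeneous iso_src iso_tgt iso_deg W W (2 * int m)"
      unfolding 4 iso_bd_cases
      by (rule R_iso.iso_odd_nth_closed[where Y = B]) (simp_all only: evens_nth odds_nth iso_gens_homogeneous)
    then show ?thesis by (simp add: 4)
  qed
  have "R_iso.D (evens f_gen * odds f_gen - odds g_gen * evens f_gen) = 0"
    "R_iso.D (evens g_gen * odds g_gen - odds f_gen * evens g_gen) = 0"
    unfolding R_iso.bianchi(1)[OF E(1,2,3,4)] R_iso.bianchi(1)[OF E(2,1,4,3)]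
    by (simp_all only: D_iso_gens) simp_all
  then have "R_iso.D (iso_even (evens f_gen) (odds f_gen) (odds g_gen)) = 0"
    "R_iso.D (iso_even (evens g_gen) (odds g_gen) (odds f_gen)) = 0"
    by (simp_all add: iso_even_def R_iso.D_fps_X_mult)
  moreover have "R_iso.D (iso_odd (evens f_gen) (evens g_gen) (odds f_gen)) = 0"
    "R_iso.D (iso_odd (evens g_gen) (evens f_gen) (odds g_gen)) = 0"
    unfolding R_iso.bianchi(2)[OF E(1,2,3,4)] R_iso.bianchi(2)[OF E(2,1,4,3)]
    by (simp_all only: D_iso_gens) simp_all
  ultimately show "free_bd iso_deg iso_bd (iso_bd a) = 0"
    by (cases a rule: iso_gen_parity_cases)
      (simp_all only: iso_bd_cases flip: fps_map_nth, simp_all)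
qed

section \<open>The free operad on a homotopy equivalence with one filled obstruction\<close>

datatype half_gen = hF | hG | hH | hL | hP

fun half_src :: "half_gen \<Rightarrow> color" where
  "half_src hF = B" | "half_src hG = W" | "half_src hH = B" | "half_src hL = W" | "half_src hP = B"

fun half_tgt :: "half_gen \<Rightarrow> color" where
  "half_tgt hF = W" | "half_tgt hG = B" | "half_tgt hH = B" | "half_tgt hL = W" | "half_tgt hP = W"

fun half_deg :: "half_gen \<Rightarrow> int" where
  "half_deg hF = 0" | "half_deg hG = 0" | "half_deg hH = 1" | "half_deg hL = 1" | "half_deg hP = 2"

fun half_bd :: "half_gen \<Rightarrow> half_gen list \<Rightarrow>\<^sub>0 int" where
  "half_bd hF = 0"
| "half_bd hG = 0"
| "half_bd hH = frag_of [hG, hF] - frag_of []"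
| "half_bd hL = frag_of [hF, hG] - frag_of []"
| "half_bd hP = frag_of [hF, hH] - frag_of [hL, hF]"

interpretation half: dg_ring "homogeneous half_src half_tgt half_deg" "parity half_deg" "free_bd half_deg half_bd"
  by (rule free_dg_ring)

text \<open>The square of the differential vanishes on \<open>hP\<close> because both terms of its
  boundary have the same boundary: F (G F - 1) = (F G - 1) F.\<close>

interpretation half: free_dg half_src half_tgt half_deg half_bd
proof
  fix a
  show "half_bd a \<in> homogeneous half_src half_tgt half_deg (half_src a) (half_tgt a) (half_deg a - 1)"
    by (cases a) (auto intro!: homogeneous_diff simp: homogeneous_0 homogeneous_frag_of words_def)
  show "free_bd half_deg half_bd (half_bd a) = 0"
    by (cases a)
      (simp_all add: half.d_zero half.d_diff half.d_one frag_of_pair frag_of_Nil half.d_mult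
        free_bd_frag_of_letter parity_frag_of algebra_simps)
qed

definition "half_operad = free_operad half_src half_tgt half_deg half_bd"

text \<open>The coefficients of the recursive solution are read as images of the generators. Since
  \<open>subst \<alpha>\<close> preserves the form of \<open>iso_rel\<close>, the four series
  relations say that \<open>\<alpha>\<close> is compatible with the differential on every
  generator.\<close>

lemma half_solution_exists:
  obtains \<alpha> :: "iso_gen \<Rightarrow> half_gen list \<Rightarrow>\<^sub>0 int" where
    "\<alpha> (Fg 0) = frag_of [hF]" "\<alpha> (Gg 0) = frag_of [hG]"
    "\<alpha> (Fg 1) = frag_of [hH]" "\<alpha> (Gg 1) = frag_of [hL]"
    "\<And>a. \<alpha> a \<in> homogeneous half_src half_tgt half_deg (iso_src a) (iso_tgt a) (iso_deg a)"
    "\<And>a. free_bd half_deg half_bd (\<alpha> a) = subst \<alpha> (iso_bd a)"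
proof -
  obtain x y \<phi> \<gamma> where init: "fps_nth x 0 = frag_of [hF]" "fps_nth y 0 = frag_of [hG]"
      "fps_nth \<phi> 0 = frag_of [hH]" "fps_nth \<gamma> 0 = frag_of [hL]"
    and closed: "\<And>n. fps_nth x n \<in> homogeneous half_src half_tgt half_deg B W (2 * int n)"
      "\<And>n. fps_nth y n \<in> homogeneous half_src half_tgt half_deg W B (2 * int n)"
      "\<And>n. fps_nth \<phi> n \<in> homogeneous half_src half_tgt half_deg B B (2 * int n + 1)"
      "\<And>n. fps_nth \<gamma> n \<in> homogeneous half_src half_tgt half_deg W W (2 * int n + 1)"
    and D: "half.D x = iso_even x \<phi> \<gamma>" "half.D y = iso_even y \<gamma> \<phi>"
      "half.D \<phi> = iso_odd x y \<phi>" "half.D \<gamma> = iso_odd y x \<gamma>"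
  proof (rule half.iso_series_exist[of "frag_of [hF]" "frag_of [hG]" "frag_of [hH]" "frag_of [hL]" "frag_of [hP]"])
  qed (simp_all add: homogeneous_frag_of words_def free_bd_frag_of_letter frag_of_pair frag_of_Nil)
  define \<alpha> where "\<alpha> a = (case a of
      Fg n \<Rightarrow> if even n then fps_nth x (n div 2) else fps_nth \<phi> (n div 2)
    | Gg n \<Rightarrow> if even n then fps_nth y (n div 2) else fps_nth \<gamma> (n div 2))" for a
  have series: "evens (\<lambda>i. \<alpha> (Fg i)) = x" "odds (\<lambda>i. \<alpha> (Fg i)) = \<phi>"
    "evens (\<lambda>i. \<alpha> (Gg i)) = y" "odds (\<lambda>i. \<alpha> (Gg i)) = \<gamma>"
    by (auto intro!: fps_ext simp: \<alpha>_def)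
  have "subst \<alpha> (iso_bd (Fg n)) = iso_rel (\<lambda>i. \<alpha> (Fg i)) (\<lambda>i. \<alpha> (Gg i)) n"
    "subst \<alpha> (iso_bd (Gg n)) = iso_rel (\<lambda>i. \<alpha> (Gg i)) (\<lambda>i. \<alpha> (Fg i)) n" for n
    by (simp_all add: iso_bd_gen_eq_iso_rel subst_iso_rel subst_frag_of)
  then have bd: "free_bd half_deg half_bd (\<alpha> a) = subst \<alpha> (iso_bd a)" for a
    by (cases a rule: iso_gen_parity_cases)
      (simp_all only: iso_rel_even iso_rel_odd series D[symmetric], simp_all add: \<alpha>_def)
  have "\<alpha> a \<in> homogeneous half_src half_tgt half_deg (iso_src a) (iso_tgt a) (iso_deg a)" for a
    using closed by (cases a rule: iso_gen_parity_cases) (simp_all add: \<alpha>_def add.commute)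
  with bd show thesis
    using that[of \<alpha>] init by (simp add: \<alpha>_def)
qed

section \<open>Morphisms out of free operads\<close>

lemma (in group) int_pow_ksign:
  "x \<in> carrier G \<Longrightarrow> x [^] ksign n = (if even n then x else inv x)"
  using int_pow_neg[of x 1] by (simp add: ksign_def)

context colored_operad
begin

lemma comm_group_ops: "comm_group (ops P X Y n)"
  using chain_complex_arr chain_complex.comm_group_grp by blast

lemma group_ops: "group (ops P X Y n)"
  using comm_group_ops comm_group_def by blast

lemma bd_hom_ops: "bd (arr P X Y) n \<in> hom (ops P X Y n) (ops P X Y (n - 1))"
  using chain_complex_arr chain_complex.bd_hom by blast

lemma cmp_hom_left:
  "v \<in> carrier (ops P X Y q) \<Longrightarrow> (\<lambda>u. cmp P X Y Z p q u v) \<in> hom (ops P Y Z p) (ops P X Z (p + q))"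
  by (auto simp: hom_def cmp_closed cmp_left_add)

lemma cmp_hom_right:
  "u \<in> carrier (ops P Y Z p) \<Longrightarrow> cmp P X Y Z p q u \<in> hom (ops P X Y q) (ops P X Z (p + q))"
  by (auto simp: hom_def cmp_closed cmp_right_add)

lemma group_homI: "h \<in> hom (ops P X Y m) (ops P Z V n) \<Longrightarrow> group_hom (ops P X Y m) (ops P Z V n) h"
  by (simp add: group_hom_def group_hom_axioms_def group_ops)

lemmas cmp_one_left = group_hom.hom_one[OF group_homI[OF cmp_hom_left]]
  and cmp_inv_left = group_hom.hom_inv[OF group_homI[OF cmp_hom_left]]
  and cmp_one_right = group_hom.hom_one[OF group_homI[OF cmp_hom_right]]
  and cmp_inv_right = group_hom.hom_inv[OF group_homI[OF cmp_hom_right]]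
  and bd_one = group_hom.hom_one[OF group_homI[OF bd_hom_ops]]
  and bd_inv = group_hom.hom_inv[OF group_homI[OF bd_hom_ops]]
  and bd_mult = group_hom.hom_mult[OF group_homI[OF bd_hom_ops]]

end

text \<open>The universal property of the free operad, in stages: \<open>\<alpha>\<close> is
  extended multiplicatively to words and additively to sums, and the result is a dg morphism once it
  respects the differential on letters.\<close>

locale free_operad_eval = free_dg s t deg \<delta> + colored_operad Q
  for s t :: "'s \<Rightarrow> color" and deg :: "'s \<Rightarrow> int" and \<delta> and Q :: "'m pre_operad" +
  fixes \<alpha> :: "'s \<Rightarrow> 'm"
  assumes \<alpha>_closed: "\<alpha> a \<in> carrier (ops Q (s a) (t a) (deg a))"
begin

text \<open>The source color is a parameter because the empty list does not record at which color it
  stands.\<close>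

fun word_eval :: "color \<Rightarrow> 's list \<Rightarrow> 'm" where
  "word_eval X [] = ident Q X"
| "word_eval X (a # w) = cmp Q X (s a) (t a) (deg a) (word_deg deg w) (\<alpha> a) (word_eval X w)"

lemma word_eval_closed: "is_word s t X Y w \<Longrightarrow> word_eval X w \<in> carrier (ops Q X Y (word_deg deg w))"
  by (induction w arbitrary: Y) (auto simp: ident_closed intro!: cmp_closed[OF \<alpha>_closed])

lemma word_eval_append:
  "is_word s t Y Z u \<Longrightarrow> is_word s t X Y v \<Longrightarrow>
    word_eval X (u @ v) = cmp Q X Y Z (word_deg deg u) (word_deg deg v) (word_eval Y u) (word_eval X v)"
proof (induction u arbitrary: Z)
  case Nil
  then show ?case by (simp add: cmp_ident_left word_eval_closed)
next
  case (Cons a u)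
  then show ?case
    by (auto simp: cmp_assoc[OF \<alpha>_closed word_eval_closed word_eval_closed])
qed

definition evaluate :: "color \<Rightarrow> color \<Rightarrow> int \<Rightarrow> ('s list \<Rightarrow>\<^sub>0 int) \<Rightarrow> 'm" where
  "evaluate X Y n = (SOME h. h \<in> hom (free_Abelian_group (words s t deg X Y n)) (ops Q X Y n) \<and>
     (\<forall>w\<in>words s t deg X Y n. h (frag_of w) = word_eval X w))"

lemma evaluate_hom: "evaluate X Y n \<in> hom (free_Abelian_group (words s t deg X Y n)) (ops Q X Y n)" (is ?hom)
  and evaluate_word: "w \<in> words s t deg X Y n \<Longrightarrow> evaluate X Y n (frag_of w) = word_eval X w"
proof -
  have "\<exists>h. h \<in> hom (free_Abelian_group (words s t deg X Y n)) (ops Q X Y n) \<and>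
      (\<forall>w\<in>words s t deg X Y n. h (frag_of w) = word_eval X w)"
  proof (rule comm_group.free_Abelian_group_universal[OF comm_group_ops])
    show "word_eval X ` words s t deg X Y n \<subseteq> carrier (ops Q X Y n)"
      using word_eval_closed by (auto simp: words_def)
  qed blast
  from someI_ex[OF this] have "?hom \<and> (\<forall>w\<in>words s t deg X Y n. evaluate X Y n (frag_of w) = word_eval X w)"
    unfolding evaluate_def .
  then show ?hom "w \<in> words s t deg X Y n \<Longrightarrow> evaluate X Y n (frag_of w) = word_eval X w"
    by auto
qed

lemma evaluate_group_hom: "group_hom (free_Abelian_group (words s t deg X Y n)) (ops Q X Y n) (evaluate X Y n)"
  by (simp add: group_hom_def group_hom_axioms_def group_ops evaluate_hom)

lemma evaluate_closed: "x \<in> homogeneous s t deg X Y n \<Longrightarrow> evaluate X Y n x \<in> carrier (ops Q X Y n)"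
  using hom_in_carrier[OF evaluate_hom] by (simp add: carrier_free_Abelian_group_words del: carrier_free_Abelian_group_iff)

lemma evaluate_0: "evaluate X Y n 0 = \<one>\<^bsub>ops Q X Y n\<^esub>"
  using group_hom.hom_one[OF evaluate_group_hom] by simp

lemma evaluate_add:
  "x \<in> homogeneous s t deg X Y n \<Longrightarrow> y \<in> homogeneous s t deg X Y n \<Longrightarrow>
    evaluate X Y n (x + y) = evaluate X Y n x \<otimes>\<^bsub>ops Q X Y n\<^esub> evaluate X Y n y"
  using group_hom.hom_mult[OF evaluate_group_hom, of x X Y n y] by (simp add: homogeneous_def)

lemma evaluate_uminus:
  "x \<in> homogeneous s t deg X Y n \<Longrightarrow> evaluate X Y n (- x) = inv\<^bsub>ops Q X Y n\<^esub> evaluate X Y n x"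
  using group_hom.hom_inv[OF evaluate_group_hom, of x X Y n] by (simp add: homogeneous_def)

lemma evaluate_diff:
  "x \<in> homogeneous s t deg X Y n \<Longrightarrow> y \<in> homogeneous s t deg X Y n \<Longrightarrow>
    evaluate X Y n (x - y) = evaluate X Y n x \<otimes>\<^bsub>ops Q X Y n\<^esub> inv\<^bsub>ops Q X Y n\<^esub> evaluate X Y n y"
  using evaluate_add[of x X Y n "- y"] by (simp add: evaluate_uminus uminus_closed)

lemma evaluate_letter: "evaluate (s a) (t a) (deg a) (frag_of [a]) = \<alpha> a"
  by (subst evaluate_word) (simp_all add: words_def cmp_ident_right[OF \<alpha>_closed])

lemma evaluate_one: "evaluate X X 0 1 = ident Q X"
  by (simp add: evaluate_word words_def flip: frag_of_Nil)

lemma evaluate_mult: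
  assumes x: "x \<in> homogeneous s t deg Y Z p" and y: "y \<in> homogeneous s t deg X Y q"
  shows "evaluate X Z (p + q) (x * y) = cmp Q X Y Z p q (evaluate Y Z p x) (evaluate X Y q y)"
proof -
  have word: "evaluate X Z (p + q) (frag_of u * y) = cmp Q X Y Z p q (evaluate Y Z p (frag_of u)) (evaluate X Y q y)"
    if u: "is_word s t Y Z u" "word_deg deg u = p" for u
  proof -
    have u': "frag_of u \<in> homogeneous s t deg Y Z p"
      using u by (simp add: homogeneous_frag_of words_def)
    from y show ?thesis
    proof (induction rule: homogeneous_induct)
      case zero
      then show ?case
        by (simp add: evaluate_0 cmp_one_right evaluate_closed u')
    next
      case (word v)
      then show ?case
        using u is_word_append[of s t Y Z u X v] word_eval_append[of Y Z u X v]
        by (simp add: evaluate_word words_def flip: frag_of_append)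
    next
      case (diff v w)
      then show ?case
        by (simp add: right_diff_distrib evaluate_diff mult_closed[OF u'] cmp_right_add cmp_inv_right
            evaluate_closed u' group.inv_closed[OF group_ops])
    qed
  qed
  from x show ?thesis
  proof (induction rule: homogeneous_induct)
    case zero
    then show ?case using y by (simp add: evaluate_0 cmp_one_left evaluate_closed)
  next
    case (diff v w)
    then show ?case
      using y by (simp add: left_diff_distrib evaluate_diff mult_closed[OF _ y] cmp_left_add cmp_inv_left
          evaluate_closed group.inv_closed[OF group_ops])
  qed (simp add: word)
qed

lemma evaluate_parity:
  assumes "x \<in> homogeneous s t deg X Y n"
  shows "evaluate X Y n (if even p then x else - x) = evaluate X Y n x [^]\<^bsub>ops Q X Y n\<^esub> ksign p"
  using assms by (simp add: group.int_pow_ksign[OF group_ops] evaluate_closed evaluate_uminus)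

text \<open>Both sides obey the same Leibniz rule when a letter is split off a word, so agreement on
  letters propagates by induction on the word and then additively.\<close>

lemma evaluate_free_bd:
  assumes bd_\<alpha>: "\<And>a. bd (arr Q (s a) (t a)) (deg a) (\<alpha> a) = evaluate (s a) (t a) (deg a - 1) (\<delta> a)"
    and x: "x \<in> homogeneous s t deg X Y n"
  shows "evaluate X Y (n - 1) (free_bd deg \<delta> x) = bd (arr Q X Y) n (evaluate X Y n x)"
  using x
proof (induction rule: homogeneous_induct)
  case zero
  show ?case by (simp add: d_zero evaluate_0 bd_one)
next
  case (word w)
  then show ?case
  proof (induction w arbitrary: Y n)
    case Nil
    then show ?case
      by (auto simp: frag_of_Nil d_one evaluate_0 evaluate_one bd_ident)
  next
    case (Cons a w)
    define m where "m = word_deg deg w"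
    have w: "is_word s t X (s a) w" and Y: "Y = t a" and n: "n = deg a + m"
      using Cons.prems by (auto simp: m_def)
    have wK: "frag_of w \<in> homogeneous s t deg X (s a) m"
      using w by (simp add: homogeneous_frag_of words_def m_def)
    have IH: "evaluate X (s a) (m - 1) (free_bd deg \<delta> (frag_of w)) = bd (arr Q X (s a)) m (evaluate X (s a) m (frag_of w))"
      using Cons.IH[OF w] by (simp add: m_def)
    have idx: "deg a - 1 + m = n - 1" "deg a + (m - 1) = n - 1" "deg a + m - 1 = n - 1"
      using n by simp_all
    have K1: "\<delta> a * frag_of w \<in> homogeneous s t deg X Y (n - 1)"
      using mult_closed[OF \<delta>_homogeneous wK] by (simp only: idx Y)
    have K2: "frag_of [a] * free_bd deg \<delta> (frag_of w) \<in> homogeneous s t deg X Y (n - 1)"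
      using mult_closed[OF letter_closed free_bd_closed[OF wK]] by (simp only: idx Y)
    \<comment> \<open>The Leibniz sign stays a case distinction in the free group;
      \<open>evaluate\<close> turns it into the integer power that occurs in
      \<open>bd_cmp\<close>.\<close>
    have K2': "(if even (deg a) then frag_of [a] * free_bd deg \<delta> (frag_of w)
        else - (frag_of [a] * free_bd deg \<delta> (frag_of w))) \<in> homogeneous s t deg X Y (n - 1)"
      using K2 by (simp add: uminus_closed)
    have "free_bd deg \<delta> (frag_of (a # w)) = \<delta> a * frag_of w +
        (if even (deg a) then frag_of [a] * free_bd deg \<delta> (frag_of w)
         else - (frag_of [a] * free_bd deg \<delta> (frag_of w)))"
      using parity_homogeneous[OF letter_closed[of a]] by (simp add: free_bd_frag_of_Cons)
    then have "evaluate X Y (n - 1) (free_bd deg \<delta> (frag_of (a # w))) =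
        evaluate X Y (n - 1) (\<delta> a * frag_of w) \<otimes>\<^bsub>ops Q X Y (n - 1)\<^esub>
        evaluate X Y (n - 1) (frag_of [a] * free_bd deg \<delta> (frag_of w)) [^]\<^bsub>ops Q X Y (n - 1)\<^esub> ksign (deg a)"
      by (simp only: evaluate_add[OF K1 K2'] evaluate_parity[OF K2])
    also have "evaluate X Y (n - 1) (\<delta> a * frag_of w) =
        cmp Q X (s a) (t a) (deg a - 1) m (bd (arr Q (s a) (t a)) (deg a) (\<alpha> a)) (evaluate X (s a) m (frag_of w))"
      using evaluate_mult[OF \<delta>_homogeneous[of a] wK] by (simp only: idx Y bd_\<alpha>)
    also have "evaluate X Y (n - 1) (frag_of [a] * free_bd deg \<delta> (frag_of w)) =
        cmp Q X (s a) (t a) (deg a) (m - 1) (\<alpha> a) (bd (arr Q X (s a)) m (evaluate X (s a) m (frag_of w)))"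
      using evaluate_mult[OF letter_closed[of a] free_bd_closed[OF wK]]
      by (simp only: idx Y evaluate_letter IH)
    also have "cmp Q X (s a) (t a) (deg a - 1) m (bd (arr Q (s a) (t a)) (deg a) (\<alpha> a)) (evaluate X (s a) m (frag_of w))
          \<otimes>\<^bsub>ops Q X Y (n - 1)\<^esub>
        cmp Q X (s a) (t a) (deg a) (m - 1) (\<alpha> a) (bd (arr Q X (s a)) m (evaluate X (s a) m (frag_of w)))
          [^]\<^bsub>ops Q X Y (n - 1)\<^esub> ksign (deg a)
        = bd (arr Q X Y) n (cmp Q X (s a) (t a) (deg a) m (\<alpha> a) (evaluate X (s a) m (frag_of w)))"
      using bd_cmp[OF \<alpha>_closed[of a] evaluate_closed[OF wK]] by (simp only: idx Y n[symmetric])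
    also have "cmp Q X (s a) (t a) (deg a) m (\<alpha> a) (evaluate X (s a) m (frag_of w)) = evaluate X Y n (frag_of (a # w))"
      using Cons.prems w by (simp add: evaluate_word words_def m_def Y)
    finally show ?case .
  qed
next
  case (diff x y)
  then show ?case
    by (simp add: d_diff evaluate_diff free_bd_closed bd_mult bd_inv evaluate_closed group.inv_closed[OF group_ops])
qed

lemma operad_morphism_eval:
  assumes "\<And>a. bd (arr Q (s a) (t a)) (deg a) (\<alpha> a) = evaluate (s a) (t a) (deg a - 1) (\<delta> a)"
  shows "operad_morphism (free_operad s t deg \<delta>) Q evaluate"
proof (intro operad_morphism.intro operad_morphism_axioms.intro)
  show "colored_operad (free_operad s t deg \<delta>)"
    by (rule colored_operad_free_operad)
  show "colored_operad Q" ..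
qed (simp_all add: carrier_free_Abelian_group_words evaluate_hom evaluate_free_bd[OF assms] evaluate_mult evaluate_one
    del: carrier_free_Abelian_group_iff)

end

section \<open>Morphisms out of \<open>R_iso\<close> through the universal solution\<close>

lemma operad_morphism_comp:
  assumes "operad_morphism P Q A" "operad_morphism Q R A'"
  shows "operad_morphism P R (\<lambda>X Y n x. A' X Y n (A X Y n x))"
proof -
  interpret A: operad_morphism P Q A by fact
  interpret A': operad_morphism Q R A' by fact
  have closed: "A X Y n u \<in> carrier (ops Q X Y n)" if "u \<in> carrier (ops P X Y n)" for X Y n u
    using hom_in_carrier[OF A.map_hom that] .
  show ?thesis
  proof
    show "(\<lambda>x. A' X Y n (A X Y n x)) \<in> hom (ops P X Y n) (ops R X Y n)" for X Y n
      using hom_compose[OF A.map_hom A'.map_hom] by (simp add: o_def)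
  qed (simp_all add: closed A.map_bd A'.map_bd A.map_cmp A'.map_cmp A.map_ident A'.map_ident)
qed

lemma half_operad_simps:
  "ops half_operad X Y n = free_Abelian_group (words half_src half_tgt half_deg X Y n)"
  "bd (arr half_operad X Y) n = free_bd half_deg half_bd"
  "cmp half_operad X Y Z p q u v = u * v"
  "ident half_operad X = 1"
  by (simp_all add: half_operad_def)

lemma R_iso_to_half:
  obtains A where "operad_morphism R_iso half_operad A"
    "A B W 0 (frag_of [Fg 0]) = frag_of [hF]" "A W B 0 (frag_of [Gg 0]) = frag_of [hG]"
    "A B B 1 (frag_of [Fg 1]) = frag_of [hH]" "A W W 1 (frag_of [Gg 1]) = frag_of [hL]"
proof -
  obtain \<alpha> where \<alpha>: "\<alpha> (Fg 0) = frag_of [hF]" "\<alpha> (Gg 0) = frag_of [hG]"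
      "\<alpha> (Fg 1) = frag_of [hH]" "\<alpha> (Gg 1) = frag_of [hL]"
    and closed: "\<And>a. \<alpha> a \<in> homogeneous half_src half_tgt half_deg (iso_src a) (iso_tgt a) (iso_deg a)"
    and bd: "\<And>a. free_bd half_deg half_bd (\<alpha> a) = subst \<alpha> (iso_bd a)"
    by (rule half_solution_exists) blast
  interpret Q: colored_operad half_operad
    unfolding half_operad_def by (rule half.colored_operad_free_operad)
  interpret ev: free_operad_eval iso_src iso_tgt iso_deg iso_bd half_operad \<alpha>
    by unfold_locales
      (use closed in \<open>simp add: half_operad_simps carrier_free_Abelian_group_words del: carrier_free_Abelian_group_iff\<close>)
  \<comment> \<open>Composition in \<open>half_operad\<close> is the ring product, so evaluation
    there is substitution, and compatibility with the differential on letters is the equation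
    \<open>bd\<close>.\<close>
  have word_eval: "ev.word_eval X w = subst \<alpha> (frag_of w)" for X w
    by (induction w) (simp_all add: half_operad_simps subst_frag_of)
  have evaluate: "ev.evaluate X Y n x = subst \<alpha> x"
    if "x \<in> homogeneous iso_src iso_tgt iso_deg X Y n" for X Y n x
    using that
  proof (induction rule: homogeneous_induct)
    case zero
    then show ?case by (simp add: ev.evaluate_0 subst_0) (simp add: half_operad_simps)
  next
    case (word w)
    then show ?case by (simp add: ev.evaluate_word words_def word_eval)
  next
    case (diff x y)
    then show ?case
      using ev.evaluate_closed[OF diff(1)] ev.evaluate_closed[OF diff(2)]
      by (simp add: ev.evaluate_diff subst_diff) (simp add: half_operad_simps)
  qed
  have "operad_morphism R_iso half_operad ev.evaluate"
    unfolding R_iso_def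
    by (rule ev.operad_morphism_eval)
      (simp add: evaluate[OF R_iso.\<delta>_homogeneous] bd half_operad_simps)
  then show thesis
    using that[of ev.evaluate] ev.evaluate_letter[of "Fg 0"] ev.evaluate_letter[of "Gg 0"]
      ev.evaluate_letter[of "Fg 1"] ev.evaluate_letter[of "Gg 1"] \<alpha> by simp
qed

text \<open>The universal morphism into \<open>half_operad\<close> is composed with the evaluation
  sending \<open>hF\<close>, \<open>hG\<close>, \<open>hH\<close>, \<open>hL\<close>,
  \<open>hP\<close> to the given elements. The five equations say that this evaluation commutes with
  the differential on letters.\<close>

lemma (in colored_operad) R_iso_morphism_exists:
  assumes F: "F \<in> carrier (ops P B W 0)" and G: "G \<in> carrier (ops P W B 0)"
    and H: "H \<in> carrier (ops P B B 1)" and L: "L \<in> carrier (ops P W W 1)"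
    and S: "S \<in> carrier (ops P B W 2)"
    and dF: "bd (arr P B W) 0 F = \<one>\<^bsub>ops P B W (-1)\<^esub>"
    and dG: "bd (arr P W B) 0 G = \<one>\<^bsub>ops P W B (-1)\<^esub>"
    and dH: "bd (arr P B B) 1 H = cmp P B W B 0 0 G F \<otimes>\<^bsub>ops P B B 0\<^esub> inv\<^bsub>ops P B B 0\<^esub> ident P B"
    and dL: "bd (arr P W W) 1 L = cmp P W B W 0 0 F G \<otimes>\<^bsub>ops P W W 0\<^esub> inv\<^bsub>ops P W W 0\<^esub> ident P W"
    and dS: "bd (arr P B W) 2 S =
      cmp P B B W 0 1 F H \<otimes>\<^bsub>ops P B W 1\<^esub> inv\<^bsub>ops P B W 1\<^esub> cmp P B W W 1 0 L F"
  obtains A where "operad_morphism R_iso P A"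
    "A B W 0 (frag_of [Fg 0]) = F" "A W B 0 (frag_of [Gg 0]) = G"
    "A B B 1 (frag_of [Fg 1]) = H" "A W W 1 (frag_of [Gg 1]) = L"
proof -
  define \<alpha> where "\<alpha> a = (case a of hF \<Rightarrow> F | hG \<Rightarrow> G | hH \<Rightarrow> H | hL \<Rightarrow> L | hP \<Rightarrow> S)" for a
  have \<alpha>: "\<alpha> hF = F" "\<alpha> hG = G" "\<alpha> hH = H" "\<alpha> hL = L" "\<alpha> hP = S"
    by (simp_all add: \<alpha>_def)
  interpret ev: free_operad_eval half_src half_tgt half_deg half_bd P \<alpha>
  proof unfold_locales
    show "\<alpha> a \<in> carrier (ops P (half_src a) (half_tgt a) (half_deg a))" for a
      using F G H L S by (cases a) (simp_all add: \<alpha>)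
  qed
  \<comment> \<open>The evaluation of a word ends in an identity; the unit laws at \<open>F\<close>,
    \<open>G\<close> and \<open>H\<close> remove it from the words of length two.\<close>
  have "bd (arr P (half_src a) (half_tgt a)) (half_deg a) (\<alpha> a) =
      ev.evaluate (half_src a) (half_tgt a) (half_deg a - 1) (half_bd a)" for a
    by (cases a)
      (simp_all add: \<alpha> dF dG dH dL dS ev.evaluate_0 ev.evaluate_diff homogeneous_frag_of words_def
        ev.evaluate_word cmp_ident_right[OF F] cmp_ident_right[OF G] cmp_ident_right[OF H])
  then have half: "operad_morphism half_operad P ev.evaluate"
    unfolding half_operad_def by (rule ev.operad_morphism_eval)
  obtain A' where R_iso: "operad_morphism R_iso half_operad A'"
    and A': "A' B W 0 (frag_of [Fg 0]) = frag_of [hF]" "A' W B 0 (frag_of [Gg 0]) = frag_of [hG]"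
      "A' B B 1 (frag_of [Fg 1]) = frag_of [hH]" "A' W W 1 (frag_of [Gg 1]) = frag_of [hL]"
    by (rule R_iso_to_half)
  show thesis
    using that[of "\<lambda>X Y n x. ev.evaluate X Y n (A' X Y n x)"] operad_morphism_comp[OF R_iso half] A' \<alpha>
      ev.evaluate_letter[of hF] ev.evaluate_letter[of hG] ev.evaluate_letter[of hH] ev.evaluate_letter[of hL]
    by simp
qed

section \<open>Obstructions as boundaries of the images of \<open>Fg 2\<close> and
  \<open>Gg 2\<close>\<close>

lemma R_iso_simps:
  "ops R_iso X Y n = free_Abelian_group (words iso_src iso_tgt iso_deg X Y n)"
  "bd (arr R_iso X Y) n = free_bd iso_deg iso_bd"
  "cmp R_iso X Y Z p q u v = u * v"
  "ident R_iso X = 1"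
  by (simp_all add: R_iso_def)

lemma (in operad_morphism) map_diff:
  assumes "u \<in> carrier (ops P X Y n)" "v \<in> carrier (ops P X Y n)"
  shows "A X Y n (u \<otimes>\<^bsub>ops P X Y n\<^esub> inv\<^bsub>ops P X Y n\<^esub> v) =
    A X Y n u \<otimes>\<^bsub>ops Q X Y n\<^esub> inv\<^bsub>ops Q X Y n\<^esub> A X Y n v"
proof -
  interpret group_hom "ops P X Y n" "ops Q X Y n" "A X Y n"
    by (simp add: group_hom_def group_hom_axioms_def dom.group_ops cod.group_ops map_hom)
  show ?thesis using assms by simp
qed

text \<open>A morphism carries the boundary of \<open>Fg 2\<close>, which is f_0 f_1 - g_1 f_0, to
  the first obstruction, so the image of \<open>Fg 2\<close> bounds it. \<open>Gg 2\<close> does the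
  same for the second.\<close>

lemma R_iso_morphism_obstructions:
  assumes "operad_morphism R_iso Q A"
  defines "F \<equiv> A B W 0 (frag_of [Fg 0])" and "G \<equiv> A W B 0 (frag_of [Gg 0])"
    and "H \<equiv> A B B 1 (frag_of [Fg 1])" and "L \<equiv> A W W 1 (frag_of [Gg 1])"
  shows "cmp Q B B W 0 1 F H \<otimes>\<^bsub>ops Q B W 1\<^esub> inv\<^bsub>ops Q B W 1\<^esub> cmp Q B W W 1 0 L F \<in> boundaries (arr Q B W) 1"
    and "cmp Q W W B 0 1 G L \<otimes>\<^bsub>ops Q W B 1\<^esub> inv\<^bsub>ops Q W B 1\<^esub> cmp Q W B B 1 0 H G \<in> boundaries (arr Q W B) 1"
proof -
  interpret operad_morphism R_iso Q A by fact
  have gens: "frag_of [Fg 0] \<in> carrier (ops R_iso B W 0)" "frag_of [Gg 0] \<in> carrier (ops R_iso W B 0)"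
    "frag_of [Fg 1] \<in> carrier (ops R_iso B B 1)" "frag_of [Gg 1] \<in> carrier (ops R_iso W W 1)"
    "frag_of [Fg 2] \<in> carrier (ops R_iso B W 2)" "frag_of [Gg 2] \<in> carrier (ops R_iso W B 2)"
    by (simp_all add: R_iso_simps words_def)
  have pairs: "frag_of [Fg 0, Fg 1] \<in> carrier (ops R_iso B W 1)" "frag_of [Gg 1, Fg 0] \<in> carrier (ops R_iso B W 1)"
    "frag_of [Gg 0, Gg 1] \<in> carrier (ops R_iso W B 1)" "frag_of [Fg 1, Gg 0] \<in> carrier (ops R_iso W B 1)"
    by (simp_all add: R_iso_simps words_def)
  have bd_F: "bd (arr R_iso B W) 2 (frag_of [Fg 2]) =
      frag_of [Fg 0, Fg 1] \<otimes>\<^bsub>ops R_iso B W 1\<^esub> inv\<^bsub>ops R_iso B W 1\<^esub> frag_of [Gg 1, Fg 0]"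
    and bd_G: "bd (arr R_iso W B) 2 (frag_of [Gg 2]) =
      frag_of [Gg 0, Gg 1] \<otimes>\<^bsub>ops R_iso W B 1\<^esub> inv\<^bsub>ops R_iso W B 1\<^esub> frag_of [Fg 1, Gg 0]"
    using pairs by (simp_all add: R_iso_simps free_bd_frag_of_letter iso_bd_gen_def)
  have cmps: "A B W 1 (frag_of [Fg 0, Fg 1]) = cmp Q B B W 0 1 F H"
    "A B W 1 (frag_of [Gg 1, Fg 0]) = cmp Q B W W 1 0 L F"
    "A W B 1 (frag_of [Gg 0, Gg 1]) = cmp Q W W B 0 1 G L"
    "A W B 1 (frag_of [Fg 1, Gg 0]) = cmp Q W B B 1 0 H G"
    using map_cmp[OF gens(1,3)] map_cmp[OF gens(4,1)] map_cmp[OF gens(2,4)] map_cmp[OF gens(3,2)]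
    by (simp_all add: R_iso_simps F_def G_def H_def L_def frag_of_pair)
  have "bd (arr Q B W) 2 (A B W 2 (frag_of [Fg 2])) =
      cmp Q B B W 0 1 F H \<otimes>\<^bsub>ops Q B W 1\<^esub> inv\<^bsub>ops Q B W 1\<^esub> cmp Q B W W 1 0 L F"
    using map_bd[OF gens(5)] by (simp add: bd_F map_diff pairs cmps del: One_nat_def)
  then show "cmp Q B B W 0 1 F H \<otimes>\<^bsub>ops Q B W 1\<^esub> inv\<^bsub>ops Q B W 1\<^esub> cmp Q B W W 1 0 L F \<in> boundaries (arr Q B W) 1"
    using hom_in_carrier[OF map_hom gens(5)] by (force simp: boundaries_def)
  have "bd (arr Q W B) 2 (A W B 2 (frag_of [Gg 2])) =
      cmp Q W W B 0 1 G L \<otimes>\<^bsub>ops Q W B 1\<^esub> inv\<^bsub>ops Q W B 1\<^esub> cmp Q W B B 1 0 H G"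
    using map_bd[OF gens(6)] by (simp add: bd_G map_diff pairs cmps del: One_nat_def)
  then show "cmp Q W W B 0 1 G L \<otimes>\<^bsub>ops Q W B 1\<^esub> inv\<^bsub>ops Q W B 1\<^esub> cmp Q W B B 1 0 H G \<in> boundaries (arr Q W B) 1"
    using hom_in_carrier[OF map_hom gens(6)] by (force simp: boundaries_def)
qed

section \<open>The endomorphism operad\<close>

context chain_complex
begin

lemma group_C: "group (grp C n)"
  using comm_group_grp comm_group_def by blast

lemma monoid_C: "monoid (grp C n)"
  using group_C group_def by blast

lemma bd_closed: "x \<in> carrier (grp C n) \<Longrightarrow> bd C n x \<in> carrier (grp C (n - 1))"
  by (rule hom_in_carrier[OF bd_hom])

lemma bd_group_hom: "group_hom (grp C n) (grp C (n - 1)) (bd C n)"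
  by (simp add: group_hom_def group_hom_axioms_def group_C bd_hom)

lemmas bd_mult = group_hom.hom_mult[OF bd_group_hom]
  and bd_inv = group_hom.hom_inv[OF bd_group_hom]

end

lemma graded_maps_ext:
  assumes "\<phi> \<in> graded_maps M N n" "\<psi> \<in> graded_maps M N n"
    and "\<And>k x. x \<in> carrier (grp M k) \<Longrightarrow> \<phi> k x = \<psi> k x"
  shows "\<phi> = \<psi>"
  using assms by (intro ext extensionalityI[of _ "carrier (grp M _)"]) (auto simp: graded_maps_def)

lemma graded_maps_closed:
  "\<phi> \<in> graded_maps M N n \<Longrightarrow> x \<in> carrier (grp M k) \<Longrightarrow> \<phi> k x \<in> carrier (grp N (k + n))"
  by (auto simp: graded_maps_def hom_def)

section \<open>The Hom complex of two chain complexes\<close>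

locale two_complexes = M: chain_complex M + N: chain_complex N
  for M :: "'a pre_complex" and N :: "'b pre_complex"
begin

lemma component_group_hom:
  "\<phi> \<in> graded_maps M N n \<Longrightarrow> group_hom (grp M k) (grp N (k + n)) (\<phi> k)"
  by (simp add: group_hom_def group_hom_axioms_def M.group_C N.group_C graded_maps_def)

lemmas component_mult = group_hom.hom_mult[OF component_group_hom]
  and component_inv = group_hom.hom_inv[OF component_group_hom]
  and component_one = group_hom.hom_one[OF component_group_hom]

text \<open>Pointwise products of homomorphisms are homomorphisms because the target groups are
  abelian.\<close>

lemma Hom_mult_closed:
  assumes "\<phi> \<in> graded_maps M N n" "\<psi> \<in> graded_maps M N n"
  shows "\<phi> \<otimes>\<^bsub>Hom_grp M N n\<^esub> \<psi> \<in> graded_maps M N n"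
proof -
  have "(\<lambda>x\<in>carrier (grp M k). \<phi> k x \<otimes>\<^bsub>grp N (k + n)\<^esub> \<psi> k x) \<in> hom (grp M k) (grp N (k + n))" for k
  proof -
    interpret N: comm_group "grp N (k + n)" by (rule N.comm_group_grp)
    interpret M: group "grp M k" by (rule M.group_C)
    show ?thesis
      using assms by (auto intro!: homI simp: component_mult graded_maps_closed N.m_ac)
  qed
  then show ?thesis
    by (simp add: graded_maps_def Hom_grp_def)
qed

lemma Hom_inverse_closed:
  assumes "\<phi> \<in> graded_maps M N n"
  shows "(\<lambda>k. \<lambda>x\<in>carrier (grp M k). inv\<^bsub>grp N (k + n)\<^esub> \<phi> k x) \<in> graded_maps M N n"
proof -
  have "(\<lambda>x\<in>carrier (grp M k). inv\<^bsub>grp N (k + n)\<^esub> \<phi> k x) \<in> hom (grp M k) (grp N (k + n))" for k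
  proof -
    interpret N: comm_group "grp N (k + n)" by (rule N.comm_group_grp)
    interpret M: group "grp M k" by (rule M.group_C)
    show ?thesis
      using assms by (auto intro!: homI simp: component_mult graded_maps_closed N.inv_mult)
  qed
  then show ?thesis
    by (simp add: graded_maps_def)
qed

lemma Hom_one_closed: "\<one>\<^bsub>Hom_grp M N n\<^esub> \<in> graded_maps M N n"
proof -
  have "(\<lambda>x\<in>carrier (grp M k). \<one>\<^bsub>grp N (k + n)\<^esub>) \<in> hom (grp M k) (grp N (k + n))" for k
    using N.monoid_C M.monoid_C by (auto intro!: homI simp: monoid.m_closed monoid.l_one)
  then show ?thesis
    by (simp add: graded_maps_def Hom_grp_def)
qed

lemma carrier_Hom [simp]: "carrier (Hom_grp M N n) = graded_maps M N n"
  by (simp add: Hom_grp_def)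

lemma Hom_mult_apply: "x \<in> carrier (grp M k) \<Longrightarrow>
    (\<phi> \<otimes>\<^bsub>Hom_grp M N n\<^esub> \<psi>) k x = \<phi> k x \<otimes>\<^bsub>grp N (k + n)\<^esub> \<psi> k x"
  and Hom_one_apply: "x \<in> carrier (grp M k) \<Longrightarrow> \<one>\<^bsub>Hom_grp M N n\<^esub> k x = \<one>\<^bsub>grp N (k + n)\<^esub>"
  by (simp_all add: Hom_grp_def)

lemma comm_group_Hom: "comm_group (Hom_grp M N n)"
proof (rule comm_groupI)
  fix \<phi> \<psi> \<chi> assume *: "\<phi> \<in> carrier (Hom_grp M N n)" "\<psi> \<in> carrier (Hom_grp M N n)" "\<chi> \<in> carrier (Hom_grp M N n)"
  show "\<phi> \<otimes>\<^bsub>Hom_grp M N n\<^esub> \<psi> \<otimes>\<^bsub>Hom_grp M N n\<^esub> \<chi> = \<phi> \<otimes>\<^bsub>Hom_grp M N n\<^esub> (\<psi> \<otimes>\<^bsub>Hom_grp M N n\<^esub> \<chi>)"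
    using * by (intro graded_maps_ext[where M = M and N = N and n = n])
      (simp_all add: Hom_mult_closed Hom_mult_apply graded_maps_closed monoid.m_assoc[OF N.monoid_C])
next
  fix \<phi> \<psi> assume *: "\<phi> \<in> carrier (Hom_grp M N n)" "\<psi> \<in> carrier (Hom_grp M N n)"
  show "\<phi> \<otimes>\<^bsub>Hom_grp M N n\<^esub> \<psi> = \<psi> \<otimes>\<^bsub>Hom_grp M N n\<^esub> \<phi>"
    using * by (intro graded_maps_ext[where M = M and N = N and n = n])
      (simp_all add: Hom_mult_closed Hom_mult_apply graded_maps_closed
        comm_monoid.m_comm[OF comm_group.axioms(1)[OF N.comm_group_grp]])
next
  fix \<phi> assume *: "\<phi> \<in> carrier (Hom_grp M N n)"
  show "\<one>\<^bsub>Hom_grp M N n\<^esub> \<otimes>\<^bsub>Hom_grp M N n\<^esub> \<phi> = \<phi>"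
    using * by (intro graded_maps_ext[where M = M and N = N and n = n])
      (simp_all add: Hom_mult_closed Hom_one_closed Hom_mult_apply Hom_one_apply graded_maps_closed
        monoid.l_one[OF N.monoid_C])
  show "\<exists>\<psi>\<in>carrier (Hom_grp M N n). \<psi> \<otimes>\<^bsub>Hom_grp M N n\<^esub> \<phi> = \<one>\<^bsub>Hom_grp M N n\<^esub>"
  proof
    show "(\<lambda>k. \<lambda>x\<in>carrier (grp M k). inv\<^bsub>grp N (k + n)\<^esub> \<phi> k x) \<in> carrier (Hom_grp M N n)"
      using * by (simp add: Hom_inverse_closed)
    show "(\<lambda>k. \<lambda>x\<in>carrier (grp M k). inv\<^bsub>grp N (k + n)\<^esub> \<phi> k x) \<otimes>\<^bsub>Hom_grp M N n\<^esub> \<phi> = \<one>\<^bsub>Hom_grp M N n\<^esub>"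
      using * by (intro graded_maps_ext[where M = M and N = N and n = n])
        (simp_all add: Hom_mult_closed Hom_one_closed Hom_inverse_closed Hom_mult_apply Hom_one_apply
          graded_maps_closed group.l_inv[OF N.group_C])
  qed
qed (simp_all add: Hom_mult_closed Hom_one_closed)

lemma group_Hom: "group (Hom_grp M N n)"
  using comm_group_Hom comm_group_def by blast

lemma Hom_inv:
  assumes "\<phi> \<in> graded_maps M N n"
  shows "inv\<^bsub>Hom_grp M N n\<^esub> \<phi> = (\<lambda>k. \<lambda>x\<in>carrier (grp M k). inv\<^bsub>grp N (k + n)\<^esub> \<phi> k x)"
proof (rule group.inv_equality[OF group_Hom])
  show "(\<lambda>k. \<lambda>x\<in>carrier (grp M k). inv\<^bsub>grp N (k + n)\<^esub> \<phi> k x) \<otimes>\<^bsub>Hom_grp M N n\<^esub> \<phi> = \<one>\<^bsub>Hom_grp M N n\<^esub>"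
    using assms by (intro graded_maps_ext[where M = M and N = N and n = n])
      (simp_all add: Hom_mult_closed Hom_one_closed Hom_inverse_closed Hom_mult_apply Hom_one_apply
        graded_maps_closed group.l_inv[OF N.group_C])
qed (simp_all add: assms Hom_inverse_closed)

lemma Hom_inv_closed: "\<phi> \<in> graded_maps M N n \<Longrightarrow> inv\<^bsub>Hom_grp M N n\<^esub> \<phi> \<in> graded_maps M N n"
  using group.inv_closed[OF group_Hom] by simp

lemma Hom_pow_ksign_apply:
  assumes "\<phi> \<in> graded_maps M N n" "x \<in> carrier (grp M k)"
  shows "(\<phi> [^]\<^bsub>Hom_grp M N n\<^esub> ksign p) k x = \<phi> k x [^]\<^bsub>grp N (k + n)\<^esub> ksign p"
  using assms by (simp add: group.int_pow_ksign[OF group_Hom] group.int_pow_ksign[OF N.group_C]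
      graded_maps_closed Hom_inv)

lemma Hom_pow_ksign_closed:
  "\<phi> \<in> graded_maps M N n \<Longrightarrow> \<phi> [^]\<^bsub>Hom_grp M N n\<^esub> ksign p \<in> graded_maps M N n"
  using group.int_pow_closed[OF group_Hom, of \<phi> n] by simp

lemma Hom_bd_apply:
  assumes "\<phi> \<in> graded_maps M N n" "x \<in> carrier (grp M k)"
  shows "Hom_bd M N n \<phi> k x = bd N (k + n) (\<phi> k x) \<otimes>\<^bsub>grp N (k + n - 1)\<^esub>
    (inv\<^bsub>grp N (k + n - 1)\<^esub> (\<phi> (k - 1) (bd M k x) [^]\<^bsub>grp N (k + n - 1)\<^esub> ksign n))"
  using assms by (simp add: Hom_bd_def)

lemma component_bd_closed:
  assumes "\<phi> \<in> graded_maps M N n" "x \<in> carrier (grp M k)"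
  shows "\<phi> (k - 1) (bd M k x) \<in> carrier (grp N (k + n - 1))"
  using graded_maps_closed[OF assms(1) M.bd_closed[OF assms(2)]] by (simp add: algebra_simps)

lemma bd_component_closed:
  assumes "\<phi> \<in> graded_maps M N n" "x \<in> carrier (grp M k)"
  shows "bd N (k + n) (\<phi> k x) \<in> carrier (grp N (k + n - 1))"
  by (rule N.bd_closed[OF graded_maps_closed[OF assms]])

lemma component_bd_mult:
  assumes "\<phi> \<in> graded_maps M N n" "x \<in> carrier (grp M k)" "y \<in> carrier (grp M k)"
  shows "\<phi> (k - 1) (bd M k x \<otimes>\<^bsub>grp M (k - 1)\<^esub> bd M k y) =
    \<phi> (k - 1) (bd M k x) \<otimes>\<^bsub>grp N (k + n - 1)\<^esub> \<phi> (k - 1) (bd M k y)"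
  using component_mult[OF assms(1) M.bd_closed[OF assms(2)] M.bd_closed[OF assms(3)]]
  by (simp add: algebra_simps)

lemma Hom_bd_closed:
  assumes \<phi>: "\<phi> \<in> graded_maps M N n"
  shows "Hom_bd M N n \<phi> \<in> graded_maps M N (n - 1)"
proof -
  have "Hom_bd M N n \<phi> k \<in> hom (grp M k) (grp N (k + (n - 1)))" for k
  proof -
    interpret N: comm_group "grp N (k + n - 1)" by (rule N.comm_group_grp)
    interpret M: group "grp M k" by (rule M.group_C)
    have "Hom_bd M N n \<phi> k \<in> hom (grp M k) (grp N (k + n - 1))"
    proof (rule homI)
      fix x y assume xy: "x \<in> carrier (grp M k)" "y \<in> carrier (grp M k)"
      then show "Hom_bd M N n \<phi> k (x \<otimes>\<^bsub>grp M k\<^esub> y) =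
          Hom_bd M N n \<phi> k x \<otimes>\<^bsub>grp N (k + n - 1)\<^esub> Hom_bd M N n \<phi> k y"
        using component_bd_closed[OF \<phi>] bd_component_closed[OF \<phi>]
        by (simp add: Hom_bd_apply[OF \<phi>] component_mult[OF \<phi>] M.bd_mult N.bd_mult graded_maps_closed[OF \<phi>]
            component_bd_mult[OF \<phi>] N.int_pow_distrib N.inv_mult N.m_ac)
    qed (simp add: Hom_bd_apply[OF \<phi>] component_bd_closed[OF \<phi>] bd_component_closed[OF \<phi>])
    then show ?thesis by (simp add: algebra_simps)
  qed
  then show ?thesis
    by (simp add: graded_maps_def Hom_bd_def)
qed

end

context two_complexes
begin

lemma Hom_bd_mult:
  assumes \<phi>: "\<phi> \<in> graded_maps M N n" and \<psi>: "\<psi> \<in> graded_maps M N n"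
  shows "Hom_bd M N n (\<phi> \<otimes>\<^bsub>Hom_grp M N n\<^esub> \<psi>) =
    Hom_bd M N n \<phi> \<otimes>\<^bsub>Hom_grp M N (n - 1)\<^esub> Hom_bd M N n \<psi>"
proof (rule graded_maps_ext[where M = M and N = N and n = "n - 1"])
  fix k x assume x: "x \<in> carrier (grp M k)"
  interpret N: comm_group "grp N (k + n - 1)" by (rule N.comm_group_grp)
  have "(\<phi> \<otimes>\<^bsub>Hom_grp M N n\<^esub> \<psi>) (k - 1) (bd M k x) =
      \<phi> (k - 1) (bd M k x) \<otimes>\<^bsub>grp N (k + n - 1)\<^esub> \<psi> (k - 1) (bd M k x)"
    using Hom_mult_apply[OF M.bd_closed[OF x], of n \<phi> \<psi>] by (simp add: algebra_simps)
  then show "Hom_bd M N n (\<phi> \<otimes>\<^bsub>Hom_grp M N n\<^esub> \<psi>) k x =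
      (Hom_bd M N n \<phi> \<otimes>\<^bsub>Hom_grp M N (n - 1)\<^esub> Hom_bd M N n \<psi>) k x"
    using component_bd_closed[OF \<phi> x] bd_component_closed[OF \<phi> x]
      component_bd_closed[OF \<psi> x] bd_component_closed[OF \<psi> x]
    by (simp add: Hom_bd_apply \<phi> \<psi> x Hom_mult_closed Hom_mult_apply add_diff_eq N.bd_mult
        graded_maps_closed[OF \<phi>] graded_maps_closed[OF \<psi>] N.int_pow_distrib N.inv_mult N.m_ac)
qed (simp_all add: \<phi> \<psi> Hom_bd_closed Hom_mult_closed)

text \<open>The terms containing two differentials of the same complex vanish. The mixed term
  appears twice, with the signs belonging to n and n - 1, and cancels.\<close>

lemma Hom_bd_Hom_bd:
  assumes \<phi>: "\<phi> \<in> graded_maps M N n"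
  shows "Hom_bd M N (n - 1) (Hom_bd M N n \<phi>) = \<one>\<^bsub>Hom_grp M N (n - 2)\<^esub>"
proof (rule graded_maps_ext[where M = M and N = N and n = "n - 2"])
  have "Hom_bd M N (n - 1) (Hom_bd M N n \<phi>) \<in> graded_maps M N (n - 1 - 1)"
    by (intro Hom_bd_closed \<phi>)
  then show "Hom_bd M N (n - 1) (Hom_bd M N n \<phi>) \<in> graded_maps M N (n - 2)"
    by simp
  fix k x assume x: "x \<in> carrier (grp M k)"
  define b where "b = \<phi> (k - 1) (bd M k x)"
  interpret N1: comm_group "grp N (k + n - 1)" by (rule N.comm_group_grp)
  interpret N2: comm_group "grp N (k + n - 2)" by (rule N.comm_group_grp)
  \<comment> \<open>The groups are indexed by integer terms, so equal degrees are first brought to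
    one form; only then do the group laws match.\<close>
  have idx: "k + n - 1 - 1 = k + n - 2" "k - 1 + n = k + n - 1" "k - 1 - 1 = k - 2" "k - 2 + n = k + n - 2"
    "k + (n - 1) = k + n - 1" "k + (n - 2) = k + n - 2"
    by simp_all
  have b: "b \<in> carrier (grp N (k + n - 1))"
    using component_bd_closed[OF \<phi> x] by (simp add: b_def)
  have db: "bd N (k + n - 1) b \<in> carrier (grp N (k + n - 2))"
    using N.bd_closed[OF b] by (simp only: idx)
  have a: "bd N (k + n) (\<phi> k x) \<in> carrier (grp N (k + n - 1))"
    using bd_component_closed[OF \<phi> x] .
  have da: "bd N (k + n - 1) (bd N (k + n) (\<phi> k x)) = \<one>\<^bsub>grp N (k + n - 2)\<^esub>"
    using N.bd_bd[OF graded_maps_closed[OF \<phi> x]] .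
  have "\<phi> (k - 2) (bd M (k - 1) (bd M k x)) = \<one>\<^bsub>grp N (k + n - 2)\<^esub>"
    using component_one[OF \<phi>, of "k - 2"] M.bd_bd[OF x] by (simp only: idx)
  then have "Hom_bd M N n \<phi> (k - 1) (bd M k x) = bd N (k + n - 1) b"
    using Hom_bd_apply[OF \<phi> M.bd_closed[OF x]] db by (simp add: idx b_def)
  moreover have "Hom_bd M N n \<phi> k x = bd N (k + n) (\<phi> k x) \<otimes>\<^bsub>grp N (k + n - 1)\<^esub>
      inv\<^bsub>grp N (k + n - 1)\<^esub> (b [^]\<^bsub>grp N (k + n - 1)\<^esub> ksign n)"
    using Hom_bd_apply[OF \<phi> x] by (simp add: b_def)
  ultimately have "Hom_bd M N (n - 1) (Hom_bd M N n \<phi>) k x =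
      bd N (k + n - 1) (bd N (k + n) (\<phi> k x) \<otimes>\<^bsub>grp N (k + n - 1)\<^esub>
        inv\<^bsub>grp N (k + n - 1)\<^esub> (b [^]\<^bsub>grp N (k + n - 1)\<^esub> ksign n))
      \<otimes>\<^bsub>grp N (k + n - 2)\<^esub> inv\<^bsub>grp N (k + n - 2)\<^esub>
        (bd N (k + n - 1) b [^]\<^bsub>grp N (k + n - 2)\<^esub> ksign (n - 1))"
    using Hom_bd_apply[OF Hom_bd_closed[OF \<phi>] x] by (simp only: idx)
  also have "\<dots> = \<one>\<^bsub>grp N (k + n - 2)\<^esub>"
    using a b db by (simp add: N.bd_mult[of _ "k + n - 1"] N.bd_inv[of _ "k + n - 1"] idx da
        N1.int_pow_ksign N2.int_pow_ksign N2.l_inv N2.r_inv)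
  finally show "Hom_bd M N (n - 1) (Hom_bd M N n \<phi>) k x = \<one>\<^bsub>Hom_grp M N (n - 2)\<^esub> k x"
    by (simp add: Hom_one_apply x idx)
qed (rule Hom_one_closed)

lemma grp_Hom_complex [simp]: "grp (Hom_complex M N) = Hom_grp M N"
  and bd_Hom_complex [simp]: "bd (Hom_complex M N) = Hom_bd M N"
  by (simp_all add: Hom_complex_def)

lemma chain_complex_Hom: "chain_complex (Hom_complex M N)"
  by (intro chain_complex.intro)
    (auto simp: comm_group_Hom Hom_bd_closed Hom_bd_mult Hom_bd_Hom_bd intro!: homI)

end

section \<open>Composition of graded maps and its Leibniz rule\<close>

lemma graded_comp_apply:
  "x \<in> carrier (grp M k) \<Longrightarrow> graded_comp M q \<psi> \<phi> k x = \<psi> (k + q) (\<phi> k x)"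
  by (simp add: graded_comp_def)

lemma graded_comp_closed:
  assumes "chain_complex M" "\<psi> \<in> graded_maps N R p" "\<phi> \<in> graded_maps M N q"
  shows "graded_comp M q \<psi> \<phi> \<in> graded_maps M R (p + q)"
proof -
  have "graded_comp M q \<psi> \<phi> k \<in> hom (grp M k) (grp R (k + (p + q)))" for k
  proof -
    have "\<psi> (k + q) \<circ> \<phi> k \<in> hom (grp M k) (grp R (k + q + p))"
      using assms by (intro hom_compose) (auto simp: graded_maps_def)
    then have "\<psi> (k + q) \<circ> \<phi> k \<in> hom (grp M k) (grp R (k + (p + q)))"
      by (simp add: algebra_simps)
    then show ?thesis
      using monoid.m_closed[OF chain_complex.monoid_C[OF assms(1)]]
      by (auto simp: hom_def graded_comp_def Pi_iff)
  qed
  then show ?thesis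
    by (simp add: graded_maps_def graded_comp_def)
qed

lemma graded_id_apply: "x \<in> carrier (grp M k) \<Longrightarrow> graded_id M k x = x"
  by (simp add: graded_id_def)

lemma graded_id_closed: "chain_complex M \<Longrightarrow> graded_id M \<in> graded_maps M M 0"
  by (auto simp: graded_maps_def graded_id_def hom_def monoid.m_closed[OF chain_complex.monoid_C])

text \<open>The Leibniz rule at one element, with \<open>a\<close>, \<open>b\<close>,
  \<open>c\<close> standing for the values of d \<psi> \<phi>, \<psi> d \<phi> and \<psi> \<phi> d.
  The middle term enters both brackets on the right and cancels.\<close>

lemma (in comm_group) signed_leibniz:
  assumes "a \<in> carrier G" "b \<in> carrier G" "c \<in> carrier G"
  shows "a \<otimes> inv (c [^] ksign (p + q)) =
    (a \<otimes> inv (b [^] ksign p)) \<otimes> (b \<otimes> inv (c [^] ksign q)) [^] ksign p"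
proof -
  have cancel: "x \<otimes> (inv x \<otimes> y) = y" "x \<otimes> (y \<otimes> inv x) = y" if "x \<in> carrier G" "y \<in> carrier G" for x y
    using that m_comm[of y "inv x"] by (simp_all flip: m_assoc)
  show ?thesis
    using assms by (simp add: int_pow_ksign inv_mult m_ac cancel)
qed

lemma Hom_bd_graded_comp:
  assumes "chain_complex M" "chain_complex N" "chain_complex R"
    and \<psi>: "\<psi> \<in> graded_maps N R p" and \<phi>: "\<phi> \<in> graded_maps M N q"
  shows "Hom_bd M R (p + q) (graded_comp M q \<psi> \<phi>) =
    graded_comp M q (Hom_bd N R p \<psi>) \<phi> \<otimes>\<^bsub>Hom_grp M R (p + q - 1)\<^esub>
    (graded_comp M (q - 1) \<psi> (Hom_bd M N q \<phi>) [^]\<^bsub>Hom_grp M R (p + q - 1)\<^esub> ksign p)"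
proof -
  interpret MN: two_complexes M N using assms by (simp add: two_complexes_def)
  interpret NR: two_complexes N R using assms by (simp add: two_complexes_def)
  interpret MR: two_complexes M R using assms by (simp add: two_complexes_def)
  have \<psi>\<phi>: "graded_comp M q \<psi> \<phi> \<in> graded_maps M R (p + q)"
    by (rule graded_comp_closed[OF assms(1) \<psi> \<phi>])
  have d\<psi>\<phi>: "graded_comp M q (Hom_bd N R p \<psi>) \<phi> \<in> graded_maps M R (p + q - 1)"
    using graded_comp_closed[OF assms(1) NR.Hom_bd_closed[OF \<psi>] \<phi>] by (simp add: algebra_simps)
  have \<psi>d\<phi>: "graded_comp M (q - 1) \<psi> (Hom_bd M N q \<phi>) \<in> graded_maps M R (p + q - 1)"
    using graded_comp_closed[OF assms(1) \<psi> MN.Hom_bd_closed[OF \<phi>]] by (simp add: algebra_simps)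
  show ?thesis
  proof (rule graded_maps_ext[where M = M and N = R and n = "p + q - 1"])
    fix k x assume x: "x \<in> carrier (grp M k)"
    interpret N: comm_group "grp N (k + q - 1)" by (rule MN.N.comm_group_grp)
    interpret R: comm_group "grp R (k + p + q - 1)" by (rule NR.N.comm_group_grp)
    have idx: "k + (p + q) = k + p + q" "k + (p + q) - 1 = k + p + q - 1" "k + (p + q - 1) = k + p + q - 1"
      "k + q + p = k + p + q" "k + q + p - 1 = k + p + q - 1" "k - 1 + q = k + q - 1" "k + (q - 1) = k + q - 1"
      "k + q - 1 + p = k + p + q - 1"
      by simp_all
    define a where "a = bd R (k + p + q) (\<psi> (k + q) (\<phi> k x))"
    define b where "b = \<psi> (k + q - 1) (bd N (k + q) (\<phi> k x))"
    define e where "e = \<phi> (k - 1) (bd M k x)"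
    have \<phi>x: "\<phi> k x \<in> carrier (grp N (k + q))"
      by (rule graded_maps_closed[OF \<phi> x])
    have d\<phi>x: "bd N (k + q) (\<phi> k x) \<in> carrier (grp N (k + q - 1))"
      by (rule MN.N.bd_closed[OF \<phi>x])
    have e: "e \<in> carrier (grp N (k + q - 1))"
      using MN.component_bd_closed[OF \<phi> x] by (simp add: e_def)
    have a: "a \<in> carrier (grp R (k + p + q - 1))"
      using MR.bd_component_closed[OF \<psi>\<phi> x] by (simp only: graded_comp_apply[OF x] idx a_def)
    have b: "b \<in> carrier (grp R (k + p + q - 1))"
      using graded_maps_closed[OF \<psi> d\<phi>x] by (simp only: idx b_def)
    have c: "\<psi> (k + q - 1) e \<in> carrier (grp R (k + p + q - 1))"
      using graded_maps_closed[OF \<psi> e] by (simp only: idx)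
    note \<psi>_mult = NR.component_mult[OF \<psi>, where k = "k + q - 1", unfolded idx]
      and \<psi>_inv = NR.component_inv[OF \<psi>, where k = "k + q - 1", unfolded idx]
    have \<psi>_pow: "\<psi> (k + q - 1) (z [^]\<^bsub>grp N (k + q - 1)\<^esub> ksign n) =
        \<psi> (k + q - 1) z [^]\<^bsub>grp R (k + p + q - 1)\<^esub> ksign n"
      if "z \<in> carrier (grp N (k + q - 1))" for z n
      using that graded_maps_closed[OF \<psi> that]
      by (simp add: N.int_pow_ksign R.int_pow_ksign \<psi>_inv idx)
    have "Hom_bd M R (p + q) (graded_comp M q \<psi> \<phi>) k x = a \<otimes>\<^bsub>grp R (k + p + q - 1)\<^esub>
        inv\<^bsub>grp R (k + p + q - 1)\<^esub> (\<psi> (k + q - 1) e [^]\<^bsub>grp R (k + p + q - 1)\<^esub> ksign (p + q))"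
      by (simp only: MR.Hom_bd_apply[OF \<psi>\<phi> x] graded_comp_apply[OF x]
          graded_comp_apply[OF MN.M.bd_closed[OF x]] idx a_def e_def)
    also have "\<dots> = (a \<otimes>\<^bsub>grp R (k + p + q - 1)\<^esub> inv\<^bsub>grp R (k + p + q - 1)\<^esub>
          (b [^]\<^bsub>grp R (k + p + q - 1)\<^esub> ksign p)) \<otimes>\<^bsub>grp R (k + p + q - 1)\<^esub>
        (b \<otimes>\<^bsub>grp R (k + p + q - 1)\<^esub> inv\<^bsub>grp R (k + p + q - 1)\<^esub>
          (\<psi> (k + q - 1) e [^]\<^bsub>grp R (k + p + q - 1)\<^esub> ksign q)) [^]\<^bsub>grp R (k + p + q - 1)\<^esub> ksign p"
      by (rule R.signed_leibniz[OF a b c])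
    also have "a \<otimes>\<^bsub>grp R (k + p + q - 1)\<^esub> inv\<^bsub>grp R (k + p + q - 1)\<^esub>
          (b [^]\<^bsub>grp R (k + p + q - 1)\<^esub> ksign p) = graded_comp M q (Hom_bd N R p \<psi>) \<phi> k x"
      by (simp only: graded_comp_apply[OF x] NR.Hom_bd_apply[OF \<psi> \<phi>x] idx a_def b_def)
    also have "b \<otimes>\<^bsub>grp R (k + p + q - 1)\<^esub> inv\<^bsub>grp R (k + p + q - 1)\<^esub>
          (\<psi> (k + q - 1) e [^]\<^bsub>grp R (k + p + q - 1)\<^esub> ksign q) =
        graded_comp M (q - 1) \<psi> (Hom_bd M N q \<phi>) k x"
      by (simp only: graded_comp_apply[OF x] MN.Hom_bd_apply[OF \<phi> x] idx e_def[symmetric] b_def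
          \<psi>_mult[OF d\<phi>x] \<psi>_inv \<psi>_pow e N.inv_closed N.int_pow_closed)
    finally show "Hom_bd M R (p + q) (graded_comp M q \<psi> \<phi>) k x =
        (graded_comp M q (Hom_bd N R p \<psi>) \<phi> \<otimes>\<^bsub>Hom_grp M R (p + q - 1)\<^esub>
        (graded_comp M (q - 1) \<psi> (Hom_bd M N q \<phi>) [^]\<^bsub>Hom_grp M R (p + q - 1)\<^esub> ksign p)) k x"
      by (simp only: MR.Hom_mult_apply[OF x] MR.Hom_pow_ksign_apply[OF \<psi>d\<phi> x] idx)
  qed (use MR.Hom_bd_closed[OF \<psi>\<phi>] d\<psi>\<phi> \<psi>d\<phi> in
      \<open>simp_all add: MR.Hom_mult_closed MR.Hom_pow_ksign_closed\<close>)
qed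

section \<open>The operad axioms for \<open>End_operad\<close>\<close>

definition color_complex :: "'a pre_complex \<Rightarrow> 'a pre_complex \<Rightarrow> color \<Rightarrow> 'a pre_complex" where
  "color_complex M N X = (case X of B \<Rightarrow> M | W \<Rightarrow> N)"

lemma color_complex_simps [simp]: "color_complex M N B = M" "color_complex M N W = N"
  by (simp_all add: color_complex_def)

lemma arr_End_operad: "arr (End_operad M N) X Y = Hom_complex (color_complex M N X) (color_complex M N Y)"
  by (simp add: End_operad_def color_complex_def Let_def)

lemma End_operad_simps:
  "ops (End_operad M N) X Y n = Hom_grp (color_complex M N X) (color_complex M N Y) n"
  "bd (arr (End_operad M N) X Y) n = Hom_bd (color_complex M N X) (color_complex M N Y) n"
  "cmp (End_operad M N) X Y Z p q u v = graded_comp (color_complex M N X) q u v"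
  "ident (End_operad M N) X = graded_id (color_complex M N X)"
  by (simp_all add: End_operad_def color_complex_def Let_def Hom_complex_def)

lemma colored_operad_End:
  assumes "chain_complex M" "chain_complex N"
  shows "colored_operad (End_operad M N)"
proof -
  let ?C = "color_complex M N"
  have cc: "chain_complex (?C X)" for X
    using assms by (cases X) simp_all
  then have two: "two_complexes (?C X) (?C Y)" for X Y
    by (simp add: two_complexes_def)
  have carrier: "carrier (Hom_grp (?C X) (?C Y) n) = graded_maps (?C X) (?C Y) n" for X Y n
    by (rule two_complexes.carrier_Hom[OF two])
  note closed = graded_comp_closed[OF cc]
  show ?thesis
  proof (intro colored_operad.intro, unfold End_operad_simps carrier)
    fix X Y Z V :: color and p q r :: int
    show "chain_complex (arr (End_operad M N) X Y)"
      unfolding arr_End_operad by (rule two_complexes.chain_complex_Hom[OF two])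
    show id: "graded_id (?C X) \<in> graded_maps (?C X) (?C X) 0"
      by (rule graded_id_closed[OF cc])
    show "Hom_bd (?C X) (?C X) 0 (graded_id (?C X)) = \<one>\<^bsub>Hom_grp (?C X) (?C X) (- 1)\<^esub>"
    proof (rule graded_maps_ext[where n = "-1"])
      show "Hom_bd (?C X) (?C X) 0 (graded_id (?C X)) \<in> graded_maps (?C X) (?C X) (- 1)"
        using two_complexes.Hom_bd_closed[OF two id] by simp
      show "\<one>\<^bsub>Hom_grp (?C X) (?C X) (- 1)\<^esub> \<in> graded_maps (?C X) (?C X) (- 1)"
        by (rule two_complexes.Hom_one_closed[OF two])
      fix k x assume x: "x \<in> carrier (grp (?C X) k)"
      then show "Hom_bd (?C X) (?C X) 0 (graded_id (?C X)) k x = \<one>\<^bsub>Hom_grp (?C X) (?C X) (- 1)\<^esub> k x"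
        using chain_complex.bd_closed[OF cc x]
        by (simp add: two_complexes.Hom_bd_apply[OF two id] two_complexes.Hom_one_apply[OF two]
            graded_id_apply group.int_pow_1[OF chain_complex.group_C[OF cc]]
            group.r_inv[OF chain_complex.group_C[OF cc]])
    qed
    fix u assume u: "u \<in> graded_maps (?C Y) (?C Z) p"
    show "graded_comp (?C Y) p (graded_id (?C Z)) u = u"
      by (rule graded_maps_ext[where n = "0 + p", OF closed[OF graded_id_closed[OF cc] u]])
        (use u in \<open>simp_all add: graded_comp_apply graded_id_apply graded_maps_closed\<close>)
    show "graded_comp (?C Y) 0 u (graded_id (?C Y)) = u"
      by (rule graded_maps_ext[where n = "p + 0", OF closed[OF u graded_id_closed[OF cc]]])
        (use u in \<open>simp_all add: graded_comp_apply graded_id_apply graded_maps_closed\<close>)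
    fix v assume v: "v \<in> graded_maps (?C X) (?C Y) q"
    show "graded_comp (?C X) q u v \<in> graded_maps (?C X) (?C Z) (p + q)"
      by (rule closed[OF u v])
    show "Hom_bd (?C X) (?C Z) (p + q) (graded_comp (?C X) q u v) =
       graded_comp (?C X) q (Hom_bd (?C Y) (?C Z) p u) v \<otimes>\<^bsub>Hom_grp (?C X) (?C Z) (p + q - 1)\<^esub>
       graded_comp (?C X) (q - 1) u (Hom_bd (?C X) (?C Y) q v) [^]\<^bsub>Hom_grp (?C X) (?C Z) (p + q - 1)\<^esub> ksign p"
      by (rule Hom_bd_graded_comp[OF cc cc cc u v])
    have idx: "k + (p + q) = k + q + p" for k
      by simp
    {
      fix u' assume u': "u' \<in> graded_maps (?C Y) (?C Z) p"
      show "graded_comp (?C X) q (u \<otimes>\<^bsub>Hom_grp (?C Y) (?C Z) p\<^esub> u') v =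
        graded_comp (?C X) q u v \<otimes>\<^bsub>Hom_grp (?C X) (?C Z) (p + q)\<^esub> graded_comp (?C X) q u' v"
        by (rule graded_maps_ext[where n = "p + q",
              OF closed[OF two_complexes.Hom_mult_closed[OF two u u'] v]
                two_complexes.Hom_mult_closed[OF two closed[OF u v] closed[OF u' v]]])
          (simp add: graded_comp_apply two_complexes.Hom_mult_apply[OF two] graded_maps_closed[OF v] idx)
    }
    {
      fix v' assume v': "v' \<in> graded_maps (?C X) (?C Y) q"
      show "graded_comp (?C X) q u (v \<otimes>\<^bsub>Hom_grp (?C X) (?C Y) q\<^esub> v') =
        graded_comp (?C X) q u v \<otimes>\<^bsub>Hom_grp (?C X) (?C Z) (p + q)\<^esub> graded_comp (?C X) q u v'"
        by (rule graded_maps_ext[where n = "p + q",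
              OF closed[OF u two_complexes.Hom_mult_closed[OF two v v']]
                two_complexes.Hom_mult_closed[OF two closed[OF u v] closed[OF u v']]])
          (simp add: graded_comp_apply two_complexes.Hom_mult_apply[OF two] graded_maps_closed[OF v]
            graded_maps_closed[OF v'] two_complexes.component_mult[OF two u] idx)
    }
    fix w assume w: "w \<in> graded_maps (?C V) (?C X) r"
    show "graded_comp (?C V) r (graded_comp (?C X) q u v) w =
        graded_comp (?C V) (q + r) u (graded_comp (?C V) r v w)"
      by (rule graded_maps_ext[where n = "p + q + r", OF closed[OF closed[OF u v] w]])
        (use closed[OF u closed[OF v w]] in
          \<open>simp_all add: graded_comp_apply graded_maps_closed[OF w] algebra_simps\<close>)
  qed
qed

section \<open>Obstructions\<close>

text \<open>Both terms have the boundary F G F - F: it is F (G F - 1) for F H and (F G - 1) F for L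
  F.\<close>

lemma (in colored_operad) obstruction_cycle:
  assumes F: "F \<in> carrier (ops P X Y 0)" and G: "G \<in> carrier (ops P Y X 0)"
    and H: "H \<in> carrier (ops P X X 1)" and L: "L \<in> carrier (ops P Y Y 1)"
    and dF: "bd (arr P X Y) 0 F = \<one>\<^bsub>ops P X Y (-1)\<^esub>"
    and dH: "bd (arr P X X) 1 H = cmp P X Y X 0 0 G F \<otimes>\<^bsub>ops P X X 0\<^esub> inv\<^bsub>ops P X X 0\<^esub> ident P X"
    and dL: "bd (arr P Y Y) 1 L = cmp P Y X Y 0 0 F G \<otimes>\<^bsub>ops P Y Y 0\<^esub> inv\<^bsub>ops P Y Y 0\<^esub> ident P Y"
  shows "bd (arr P X Y) 1 (cmp P X X Y 0 1 F H \<otimes>\<^bsub>ops P X Y 1\<^esub> inv\<^bsub>ops P X Y 1\<^esub> cmp P X Y Y 1 0 L F) =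
    \<one>\<^bsub>ops P X Y 0\<^esub>"
proof -
  interpret XY0: comm_group "ops P X Y 0" by (rule comm_group_ops)
  interpret XY1: comm_group "ops P X Y 1" by (rule comm_group_ops)
  define FGF where "FGF = cmp P X X Y 0 0 F (cmp P X Y X 0 0 G F)"
  have GF: "cmp P X Y X 0 0 G F \<in> carrier (ops P X X 0)" and FG: "cmp P Y X Y 0 0 F G \<in> carrier (ops P Y Y 0)"
    using cmp_closed[OF G F] cmp_closed[OF F G] by simp_all
  have FGF: "FGF \<in> carrier (ops P X Y 0)"
    using cmp_closed[OF F GF] by (simp add: FGF_def)
  have FH: "cmp P X X Y 0 1 F H \<in> carrier (ops P X Y 1)" and LF: "cmp P X Y Y 1 0 L F \<in> carrier (ops P X Y 1)"
    using cmp_closed[OF F H] cmp_closed[OF L F] by simp_all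
  have "cmp P X X Y 0 0 F (cmp P X Y X 0 0 G F \<otimes>\<^bsub>ops P X X 0\<^esub> inv\<^bsub>ops P X X 0\<^esub> ident P X) =
      FGF \<otimes>\<^bsub>ops P X Y 0\<^esub> inv\<^bsub>ops P X Y 0\<^esub> F"
    using cmp_right_add[OF F GF group.inv_closed[OF group_ops ident_closed]] cmp_inv_right[OF F ident_closed]
    by (simp add: FGF_def cmp_ident_right[OF F])
  then have dFH: "bd (arr P X Y) 1 (cmp P X X Y 0 1 F H) = FGF \<otimes>\<^bsub>ops P X Y 0\<^esub> inv\<^bsub>ops P X Y 0\<^esub> F"
    using bd_cmp[OF F H] cmp_one_left[OF H, of Y "-1"] FGF F by (simp add: dF dH)
  have "cmp P X Y Y 0 0 (cmp P Y X Y 0 0 F G \<otimes>\<^bsub>ops P Y Y 0\<^esub> inv\<^bsub>ops P Y Y 0\<^esub> ident P Y) F =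
      FGF \<otimes>\<^bsub>ops P X Y 0\<^esub> inv\<^bsub>ops P X Y 0\<^esub> F"
    using cmp_left_add[OF FG group.inv_closed[OF group_ops ident_closed] F] cmp_inv_left[OF F ident_closed]
      cmp_assoc[OF F G F]
    by (simp add: FGF_def cmp_ident_left[OF F])
  then have dLF: "bd (arr P X Y) 1 (cmp P X Y Y 1 0 L F) = FGF \<otimes>\<^bsub>ops P X Y 0\<^esub> inv\<^bsub>ops P X Y 0\<^esub> F"
    using bd_cmp[OF L F] cmp_one_right[OF L, of X "-1"] FGF F
    by (simp add: dF dL XY0.int_pow_ksign del: ksign_1)
  show ?thesis
    using bd_mult[OF FH XY1.inv_closed[OF LF]] bd_inv[OF LF] FGF F
    by (simp add: dFH dLF XY0.r_inv)
qed

section \<open>Vanishing of homology classes\<close>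

context chain_complex
begin

lemma boundaries_subgroup: "subgroup (boundaries C n) (grp C n)"
  using group_hom.img_is_subgroup[OF bd_group_hom, of "n + 1"] by (simp add: boundaries_def)

text \<open>The unit of the quotient is the subgroup of boundaries itself, and a coset equals the
  subgroup exactly when its representative lies in it.\<close>

lemma homology_class_eq_one_iff:
  assumes "z \<in> carrier (grp C n)"
  shows "homology_class C n z = \<one>\<^bsub>homology C n\<^esub> \<longleftrightarrow> z \<in> boundaries C n"
proof -
  interpret group "grp C n" by (rule group_C)
  have "homology_class C n z = boundaries C n \<longleftrightarrow> z \<in> boundaries C n"
    using coset_join1[OF _ assms boundaries_subgroup] coset_join2[OF assms boundaries_subgroup]
      subgroup.subset[OF boundaries_subgroup]
    by (auto simp: homology_class_def)
  then show ?thesis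
    by (simp add: homology_def FactGroup_def)
qed

end

section \<open>Chain maps and homotopies in the Hom complex\<close>

context two_complexes
begin

lemma Hom_bd_chain_map:
  assumes "chain_map M N \<phi>"
  shows "Hom_bd M N 0 \<phi> = \<one>\<^bsub>Hom_grp M N (-1)\<^esub>"
proof (rule graded_maps_ext[where M = M and N = N and n = "-1"])
  have \<phi>: "\<phi> \<in> graded_maps M N 0" using assms by (simp add: chain_map_def)
  show "Hom_bd M N 0 \<phi> \<in> graded_maps M N (- 1)"
    using Hom_bd_closed[OF \<phi>] by simp
  fix k x assume x: "x \<in> carrier (grp M k)"
  interpret N: comm_group "grp N (k - 1)" by (rule N.comm_group_grp)
  show "Hom_bd M N 0 \<phi> k x = \<one>\<^bsub>Hom_grp M N (- 1)\<^esub> k x"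
    using assms x bd_component_closed[OF \<phi> x]
    by (simp add: Hom_bd_apply[OF \<phi> x] Hom_one_apply[OF x] chain_map_def N.r_inv)
qed (rule Hom_one_closed)

text \<open>In degree 1 the sign -(-1)^1 is positive, so the differential of the Hom complex is d h
  + h d.\<close>

lemma Hom_bd_chain_homotopy:
  assumes \<phi>: "\<phi> \<in> graded_maps M N 0" and \<psi>: "\<psi> \<in> graded_maps M N 0" and h: "chain_homotopy M N \<phi> \<psi> h"
  shows "Hom_bd M N 1 h = \<phi> \<otimes>\<^bsub>Hom_grp M N 0\<^esub> inv\<^bsub>Hom_grp M N 0\<^esub> \<psi>"
proof (rule graded_maps_ext[where M = M and N = N and n = 0])
  have hK: "h \<in> graded_maps M N 1" using h by (simp add: chain_homotopy_def)
  show "Hom_bd M N 1 h \<in> graded_maps M N 0"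
    using Hom_bd_closed[OF hK] by simp
  show "\<phi> \<otimes>\<^bsub>Hom_grp M N 0\<^esub> inv\<^bsub>Hom_grp M N 0\<^esub> \<psi> \<in> graded_maps M N 0"
    by (simp add: Hom_mult_closed Hom_inv_closed \<phi> \<psi>)
  fix k x assume x: "x \<in> carrier (grp M k)"
  interpret N: comm_group "grp N k" by (rule N.comm_group_grp)
  have "h (k - 1) (bd M k x) \<in> carrier (grp N k)"
    using component_bd_closed[OF hK x] by simp
  then have "Hom_bd M N 1 h k x = bd N (k + 1) (h k x) \<otimes>\<^bsub>grp N k\<^esub> h (k - 1) (bd M k x)"
    by (simp add: Hom_bd_apply[OF hK x] N.int_pow_ksign del: ksign_1)
  then show "Hom_bd M N 1 h k x = (\<phi> \<otimes>\<^bsub>Hom_grp M N 0\<^esub> inv\<^bsub>Hom_grp M N 0\<^esub> \<psi>) k x"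
    using h x by (simp add: chain_homotopy_def Hom_mult_apply Hom_inv[OF \<psi>])
qed

end

section \<open>The given homotopy equivalence as data in \<open>End_operad\<close>\<close>

locale homotopy_inverse_data = two_complexes M N
  for M N :: "'a pre_complex" +
  fixes F G H L :: "('a, 'a) graded_map"
  assumes F: "chain_map M N F" and G: "chain_map N M G"
    and H: "chain_homotopy M M (graded_comp M 0 G F) (graded_id M) H"
    and L: "chain_homotopy N N (graded_comp N 0 F G) (graded_id N) L"
begin

sublocale MM: two_complexes M M ..
sublocale NN: two_complexes N N ..
sublocale NM: two_complexes N M ..

sublocale End: colored_operad "End_operad M N"
  by (rule colored_operad_End) unfold_locales

text \<open>The hypotheses are symmetric in the two complexes, so what is proved about the first
  obstruction also holds for the second.\<close>

lemma swap: "homotopy_inverse_data N M G F L H"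
  by unfold_locales (rule F G H L)+

lemma End_data:
  "F \<in> carrier (ops (End_operad M N) B W 0)" "G \<in> carrier (ops (End_operad M N) W B 0)"
  "H \<in> carrier (ops (End_operad M N) B B 1)" "L \<in> carrier (ops (End_operad M N) W W 1)"
  using F G H L by (simp_all add: End_operad_simps chain_map_def chain_homotopy_def)

lemma bd_End_data:
  "bd (arr (End_operad M N) B W) 0 F = \<one>\<^bsub>ops (End_operad M N) B W (-1)\<^esub>"
  "bd (arr (End_operad M N) W B) 0 G = \<one>\<^bsub>ops (End_operad M N) W B (-1)\<^esub>"
  "bd (arr (End_operad M N) B B) 1 H = cmp (End_operad M N) B W B 0 0 G F
    \<otimes>\<^bsub>ops (End_operad M N) B B 0\<^esub> inv\<^bsub>ops (End_operad M N) B B 0\<^esub> ident (End_operad M N) B"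
  "bd (arr (End_operad M N) W W) 1 L = cmp (End_operad M N) W B W 0 0 F G
    \<otimes>\<^bsub>ops (End_operad M N) W W 0\<^esub> inv\<^bsub>ops (End_operad M N) W W 0\<^esub> ident (End_operad M N) W"
proof -
  have FG: "F \<in> graded_maps M N 0" "G \<in> graded_maps N M 0"
    using F G by (simp_all add: chain_map_def)
  have "graded_comp M 0 G F \<in> graded_maps M M 0" "graded_comp N 0 F G \<in> graded_maps N N 0"
    using graded_comp_closed[OF M.chain_complex_axioms FG(2,1)]
      graded_comp_closed[OF N.chain_complex_axioms FG(1,2)] by simp_all
  then show "bd (arr (End_operad M N) B B) 1 H = cmp (End_operad M N) B W B 0 0 G F
      \<otimes>\<^bsub>ops (End_operad M N) B B 0\<^esub> inv\<^bsub>ops (End_operad M N) B B 0\<^esub> ident (End_operad M N) B"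
    "bd (arr (End_operad M N) W W) 1 L = cmp (End_operad M N) W B W 0 0 F G
      \<otimes>\<^bsub>ops (End_operad M N) W W 0\<^esub> inv\<^bsub>ops (End_operad M N) W W 0\<^esub> ident (End_operad M N) W"
    using MM.Hom_bd_chain_homotopy[OF _ graded_id_closed[OF M.chain_complex_axioms] H]
      NN.Hom_bd_chain_homotopy[OF _ graded_id_closed[OF N.chain_complex_axioms] L]
    by (simp_all add: End_operad_simps)
qed (simp_all add: End_operad_simps Hom_bd_chain_map[OF F] NM.Hom_bd_chain_map[OF G])

lemma obstruction_eq:
  "obstruction M N F H L = cmp (End_operad M N) B B W 0 1 F H \<otimes>\<^bsub>ops (End_operad M N) B W 1\<^esub>
    inv\<^bsub>ops (End_operad M N) B W 1\<^esub> cmp (End_operad M N) B W W 1 0 L F"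
  "obstruction N M G L H = cmp (End_operad M N) W W B 0 1 G L \<otimes>\<^bsub>ops (End_operad M N) W B 1\<^esub>
    inv\<^bsub>ops (End_operad M N) W B 1\<^esub> cmp (End_operad M N) W B B 1 0 H G"
  by (simp_all add: obstruction_def End_operad_simps)

lemma obstruction_closed: "obstruction M N F H L \<in> graded_maps M N 1"
  using End.cmp_closed[OF End_data(1,3)] End.cmp_closed[OF End_data(4,1)]
  by (simp add: obstruction_def End_operad_simps Hom_mult_closed Hom_inv_closed)

lemma obstruction_in_cycles: "obstruction M N F H L \<in> cycles (Hom_complex M N) 1"
  using End.obstruction_cycle[OF End_data bd_End_data(1,3,4)] obstruction_closed
  by (simp add: cycles_def kernel_def obstruction_eq[symmetric]) (simp add: End_operad_simps)

lemma obstruction_class_eq_one_iff: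
  "homology_class (Hom_complex M N) 1 (obstruction M N F H L) = \<one>\<^bsub>homology (Hom_complex M N) 1\<^esub>
    \<longleftrightarrow> obstruction M N F H L \<in> boundaries (Hom_complex M N) 1"
  by (rule chain_complex.homology_class_eq_one_iff[OF chain_complex_Hom])
    (simp add: obstruction_closed)

definition extends :: "(color \<Rightarrow> color \<Rightarrow> int \<Rightarrow> (iso_gen list \<Rightarrow>\<^sub>0 int) \<Rightarrow> ('a, 'a) graded_map) \<Rightarrow> bool" where
  "extends A \<longleftrightarrow> operad_morphism R_iso (End_operad M N) A \<and>
    A B W 0 (frag_of [Fg 0]) = F \<and> A W B 0 (frag_of [Gg 0]) = G \<and>
    A B B 1 (frag_of [Fg 1]) = H \<and> A W W 1 (frag_of [Gg 1]) = L"

lemma extends_imp_boundaries: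
  assumes "extends A"
  shows "obstruction M N F H L \<in> boundaries (Hom_complex M N) 1"
    and "obstruction N M G L H \<in> boundaries (Hom_complex N M) 1"
  using R_iso_morphism_obstructions[of "End_operad M N" A] assms
  unfolding extends_def obstruction_eq by (simp_all add: arr_End_operad)

text \<open>An element bounding the obstruction serves as the value of \<open>hP\<close>.\<close>

lemma boundaries_imp_extends:
  assumes "obstruction M N F H L \<in> boundaries (Hom_complex M N) 1"
  shows "\<exists>A. extends A"
proof -
  obtain S where S: "S \<in> graded_maps M N 2" "Hom_bd M N 2 S = obstruction M N F H L"
    using assms by (auto simp: boundaries_def)
  have "S \<in> carrier (ops (End_operad M N) B W 2)"
    "bd (arr (End_operad M N) B W) 2 S = obstruction M N F H L"
    using S by (simp_all add: End_operad_simps)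
  then show ?thesis
    using End.R_iso_morphism_exists[OF End_data, of S, OF _ bd_End_data]
    unfolding obstruction_eq extends_def by metis
qed

end

theorem theorem11:
  fixes M N :: "'a pre_complex"
    and F G H L :: "('a, 'a) graded_map"
  assumes "chain_complex M" and "chain_complex N"
    and "chain_map M N F" and "chain_map N M G"
    and "chain_homotopy M M (graded_comp M 0 G F) (graded_id M) H"
    and "chain_homotopy N N (graded_comp N 0 F G) (graded_id N) L"
  shows
    "obstruction M N F H L \<in> cycles (Hom_complex M N) 1 \<and>
     obstruction N M G L H \<in> cycles (Hom_complex N M) 1 \<and>
     (homology_class (Hom_complex M N) 1 (obstruction M N F H L) = \<one>\<^bsub>homology (Hom_complex M N) 1\<^esub>
        \<longleftrightarrow>
      homology_class (Hom_complex N M) 1 (obstruction N M G L H) = \<one>\<^bsub>homology (Hom_complex N M) 1\<^esub>) \<and>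
     ((\<exists>A. operad_morphism R_iso (End_operad M N) A \<and>
           A B W 0 (frag_of [Fg 0]) = F \<and> A W B 0 (frag_of [Gg 0]) = G \<and>
           A B B 1 (frag_of [Fg 1]) = H \<and> A W W 1 (frag_of [Gg 1]) = L)
        \<longleftrightarrow>
      homology_class (Hom_complex M N) 1 (obstruction M N F H L) = \<one>\<^bsub>homology (Hom_complex M N) 1\<^esub> \<or>
      homology_class (Hom_complex N M) 1 (obstruction N M G L H) = \<one>\<^bsub>homology (Hom_complex N M) 1\<^esub>)"
proof -
  interpret MN: homotopy_inverse_data M N F G H L
    using assms by (simp add: homotopy_inverse_data_def homotopy_inverse_data_axioms_def two_complexes_def)
  interpret NM: homotopy_inverse_data N M G F L H
    by (rule MN.swap)
  \<comment> \<open>For the converse direction the action is built on \<open>End_operad N M\<close>,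
    with the colors exchanged, from a filling of the second obstruction. It shows that the first one
    bounds, and this in turn gives the action on \<open>End_operad M N\<close>.\<close>
  have "obstruction M N F H L \<in> boundaries (Hom_complex M N) 1
      \<longleftrightarrow> obstruction N M G L H \<in> boundaries (Hom_complex N M) 1"
    using MN.boundaries_imp_extends MN.extends_imp_boundaries(2)
      NM.boundaries_imp_extends NM.extends_imp_boundaries(2) by blast
  then show ?thesis
    using MN.obstruction_in_cycles NM.obstruction_in_cycles
      MN.boundaries_imp_extends MN.extends_imp_boundaries(1)
    unfolding MN.obstruction_class_eq_one_iff NM.obstruction_class_eq_one_iff MN.extends_def[symmetric]
    by blast
qed

end
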